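(* Let $f:[0,T]\times\mathbb R\times \mathbb L^2(\nu)\to\mathbb R$ satisfy, for all $t\in[0,T]$, $y,y'\in\mathbb R$, $z,z'\in\mathbb L^2(\nu)$, $$|f(t,y,z(\cdot))-f(t,y',z'(\cdot))|\le L_f\Big[|y-y'|+\Big(\int_{\mathbb R^d}|z(x)-z'(x)|^2\,\nu(\mathrm dx)\Big)^{1/2}\Big],$$ and let $g:\mathbb R^d\to\mathbb R$ satisfy $|g(x)-g(x')|\le L_g\|x-x'\|$ for all $x,x'$. Let $(Y,U)$ be the solution of $$Y_t=g(X_T)+\int_t^T f(s,Y_s,U_s(\cdot))\,\mathrm ds-\int_t^T\int_{\mathbb R^d}U_s(x)\,\widetilde\mu(\mathrm ds,\mathrm dx),$$ and, for $n\in\mathbb N$, let $(Y^n,U^n)$ be the solution of $$Y^n_t=g(X^n_T)+\int_t^T f(s,Y^n_s,U^n_s(\cdot))\,\mathrm ds-\int_t^T\int_{\mathbb R^d}U^n_s(x)\,\widetilde\mu^n(\mathrm ds,\mathrm dx).$$ Set $\overline U^n_t(x):=U^n_t(x)\mathbf 1_{\{\|x\|\ge 1/n\}}$. Assume that the Blumenthal--Getoor index of $X$ satisfies $\beta_*<2$. Then for any $\beta\in(\beta_*,2)$ there exists a constant $C'=C'_{L_f,L_g,T}=C_{L_f,T}L_g$, where $C_{L_f,T}$ is the stability constant described in the context (depending only on $L_f$ and $T$), such that for every $n\in\mathbb N$ $$\mathbb E\Big[\sup_{t\in[0,T]}|Y^n_t-Y_t|^2\Big]^{1/2}\le C'\,\frac{C_\beta\sqrt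 T}{n^{1-\beta/2}}$$ and $$\Big(\int_0^T\int_{\mathbb R^d}\mathbb E\big[|\overline U^n_t(x)-U_t(x)|^2\big]\,\nu(\mathrm dx)\,\mathrm dt\Big)^{1/2}\le C'\,\frac{C_\beta\sqrt T}{n^{1-\beta/2}},$$ where $C_\beta=2\big(\int_{\mathbb R^d}\|x\|^\beta\nu(\mathrm dx)\big)^{1/2}$.
   Context: Fix $T>0$ and a complete stochastic basis $(\Omega,\mathcal G,\mathbb G=(\mathcal G_t)_{t\in[0,T]},\mathbb P)$ satisfying the usual conditions. $X=(X_t)_{t\in[0,T]}$ is an $\mathbb R^d$-valued pure-jump square-integrable Lévy martingale with triplet $(0,0,\nu)$, i.e. $\nu$ is a Lévy measure with $\int_{\|x\|\ge1}\|x\|^2\nu(\mathrm dx)<\infty$ and $X_t=\int_0^t\int_{\mathbb R^d}x\,\widetilde\mu(\mathrm ds,\mathrm dx)$, where $\mu$ is the Poisson random measure of the jumps $(\Delta X_t)$ and $\widetilde\mu(\mathrm ds,\mathrm dx)=\mu(\mathrm ds,\mathrm dx)-\nu(\mathrm dx)\mathrm ds$. $\mathbb G$ is the usual augmentation of the natural filtration of $X$. For $n\in\mathbb N$, put $\mu^n(\mathrm ds,\mathrm dx)=\mathbf 1_{\{\|x\|\ge1/n\}}\mu(\mathrm ds,\mathrm dx)$, $\nu^n(\mathrm dx)=\mathbf 1_{\{\|x\|\ge1/n\}}\nu(\mathrm dx)$, $\widetilde\mu^n(\mathrm ds,\mathrm dx)=\mu^n(\mathrm ds,\mathrm dx)-\nu^n(\mathrm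 dx)\mathrm ds$, and $X^n_t=\int_0^t\int_{\mathbb R^d}x\,\widetilde\mu^n(\mathrm ds,\mathrm dx)$. $\mathbb G^n=(\mathcal G^n_t)$ is the filtration generated by $X^n$. The Blumenthal--Getoor index of $X$ is $\beta_*=\inf\{\beta>0:\int_{\|x\|\le1}\|x\|^\beta\nu(\mathrm dx)<\infty\}$. For $h\in\mathbb L^2(\nu^n)$ one has $h\mathbf 1_{\{\|x\|\ge1/n\}}\in\mathbb L^2(\nu)$, and $f(t,y,h(\cdot))$ is understood as $f(t,y,h\mathbf 1_{\{\|x\|\ge1/n\}})$. It is a standing assumption that $\int_0^T|f(t,0,0)|^2\mathrm dt<\infty$. Solutions are the unique square-integrable ones: $Y$ is real-valued, càdlàg and $\mathbb G$-adapted with $\mathbb E[\sup_t|Y_t|^2]<\infty$, $U$ is $\mathbb G$-predictable with $\mathbb E[\int_0^T\int|U_t(x)|^2\nu(\mathrm dx)\mathrm dt]<\infty$; and analogously for $(Y^n,U^n)$ with $\mathbb G^n$, $\nu^n$. Stability constant: $C_{L_f,T}$ denotes a constant, depending only on $L_f$ and $T$, such that whenever the terminal values $g(X_T)$, $g(X^n_T)$ in the two BSDEs are replaced by arbitrary square-integrable $\xi$ ($\mathcal G_T$-measurable) and $\xi^n$ ($\mathcal G^n_T$-measurable), both $\mathbb E[\sup_t|Y^n_t-Y_t|^2]^{1/2}$ and $(\int_0^T\int\mathbb E[|\overline U^n_t(x)-U_t(x)|^2]\nu(\mathrm dx)\mathrm dt)^{1/2}$ are bounded by $C_{L_f,T}\,\mathbb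 E[|\xi^n-\xi|^2]^{1/2}$. *)

theory Defs
  imports "HOL-Probability.Probability"
begin

text \<open>
  Processes are functions \<open>real \<Rightarrow> 'w \<Rightarrow> _\<close>; only their values at times in \<open>{0..T}\<close> matter.
  The state space \<open>\<real>\<^sup>d\<close> is \<open>real ^ 'd\<close>. Quadratic expectations are computed in \<^typ>\<open>ennreal\<close>,
  so that no integrability is presupposed and a bound by a real number entails finiteness.
\<close>

definition esqrt :: "ennreal \<Rightarrow> ennreal" where
  "esqrt a = (if a = \<infinity> then \<infinity> else ennreal (sqrt (enn2real a)))"


section \<open>Paths, jumps and filtrations\<close>

definition cadlag :: "real \<Rightarrow> (real \<Rightarrow> 'b::topological_space) \<Rightarrow> bool" where
  "cadlag T x \<longleftrightarrow>
     (\<forall>t\<in>{0..<T}. (x \<longlongrightarrow> x t) (at_right t)) \<and>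
     (\<forall>t\<in>{0<..T}. \<exists>l. (x \<longlongrightarrow> l) (at_left t))"

definition jump :: "(real \<Rightarrow> 'w \<Rightarrow> 'b::real_normed_vector) \<Rightarrow> real \<Rightarrow> 'w \<Rightarrow> 'b" where
  "jump X t \<omega> = X t \<omega> - Lim (at_left t) (\<lambda>s. X s \<omega>)"

text \<open>The random measure \<open>\<mu>\<close> of the jumps: \<open>jump_measure T X \<omega> A\<close> is the number of times
  \<open>s \<in> (0,T]\<close> with \<open>\<Delta>X\<^sub>s \<noteq> 0\<close> and \<open>(s, \<Delta>X\<^sub>s) \<in> A\<close>.\<close>

definition jump_measure ::
  "real \<Rightarrow> (real \<Rightarrow> 'w \<Rightarrow> real ^ 'd) \<Rightarrow> 'w \<Rightarrow> (real \<times> (real ^ 'd)) measure" where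
  "jump_measure T X \<omega> =
     distr (count_space {s \<in> {0<..T}. jump X s \<omega> \<noteq> 0}) (borel \<Otimes>\<^sub>M borel) (\<lambda>s. (s, jump X s \<omega>))"

definition natural_filtration ::
  "'w measure \<Rightarrow> (real \<Rightarrow> 'w \<Rightarrow> 'b::topological_space) \<Rightarrow> real \<Rightarrow> 'w measure" where
  "natural_filtration M X t =
     sigma (space M) {X s -` A \<inter> space M |s A. s \<in> {0..t} \<and> A \<in> sets borel}"

text \<open>Usual augmentation on the time interval \<open>[0,T]\<close>: null sets are added and right limits
  are taken; \<^term>\<open>min u T\<close> makes the \<open>\<sigma>\<close>-algebra at time \<open>T\<close> the completed \<open>F\<^sub>T\<close>.\<close>

definition usual_augmentation ::
  "'w measure \<Rightarrow> real \<Rightarrow> (real \<Rightarrow> 'w measure) \<Rightarrow> real \<Rightarrow> 'w measure" where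
  "usual_augmentation M T F t =
     sigma (space M)
       (\<Inter>u\<in>{t<..}. sets (sigma (space M) (sets (F (min u T)) \<union> null_sets M)))"

definition adapted ::
  "real \<Rightarrow> (real \<Rightarrow> 'w measure) \<Rightarrow> (real \<Rightarrow> 'w \<Rightarrow> real) \<Rightarrow> bool" where
  "adapted T G Y \<longleftrightarrow> (\<forall>t\<in>{0..T}. Y t \<in> borel_measurable (G t))"

definition predictable_sigma ::
  "'w measure \<Rightarrow> real \<Rightarrow> (real \<Rightarrow> 'w measure) \<Rightarrow> (real \<times> 'w) measure" where
  "predictable_sigma M T G =
     sigma ({0..T} \<times> space M)
       ({{0} \<times> A |A. A \<in> sets (G 0)} \<union>
        {{s<..t} \<times> A |s t A. 0 \<le> s \<and> s < t \<and> t \<le> T \<and> A \<in> sets (G s)})"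

definition predictable ::
  "'w measure \<Rightarrow> real \<Rightarrow> (real \<Rightarrow> 'w measure) \<Rightarrow> (real \<Rightarrow> 'w \<Rightarrow> real ^ 'd \<Rightarrow> real) \<Rightarrow> bool" where
  "predictable M T G U \<longleftrightarrow>
     (\<lambda>((t, \<omega>), x). U t \<omega> x) \<in> borel_measurable (predictable_sigma M T G \<Otimes>\<^sub>M borel)"


section \<open>Random measures and compensated integrals\<close>

definition levy_measure :: "(real ^ 'd) measure \<Rightarrow> bool" where
  "levy_measure \<nu> \<longleftrightarrow>
     sets \<nu> = sets borel \<and> emeasure \<nu> {0} = 0 \<and>
     (\<integral>\<^sup>+ x. ennreal (min 1 ((norm x)\<^sup>2)) \<partial>\<nu>) < \<infinity>"

definition poisson_random_measure ::
  "'w measure \<Rightarrow> ('w \<Rightarrow> 'e measure) \<Rightarrow> 'e measure \<Rightarrow> bool" where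
  "poisson_random_measure M N \<Lambda> \<longleftrightarrow>
     (\<forall>\<omega>\<in>space M. sets (N \<omega>) = sets \<Lambda>) \<and>
     (\<forall>A\<in>sets \<Lambda>. (\<lambda>\<omega>. emeasure (N \<omega>) A) \<in> borel_measurable M) \<and>
     (\<forall>A\<in>sets \<Lambda>. emeasure \<Lambda> A < \<infinity> \<longrightarrow>
        (\<forall>k. measure M {\<omega> \<in> space M. emeasure (N \<omega>) A = of_nat k}
               = measure \<Lambda> A ^ k / fact k * exp (- measure \<Lambda> A))) \<and>
     (\<forall>A\<in>sets \<Lambda>. emeasure \<Lambda> A = \<infinity> \<longrightarrow> (AE \<omega> in M. emeasure (N \<omega>) A = \<infinity>)) \<and>
     (\<forall>m (A :: nat \<Rightarrow> 'e set). (\<forall>i<m. A i \<in> sets \<Lambda>) \<and> disjoint_family_on A {..<m} \<longrightarrow>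
        prob_space.indep_vars M (\<lambda>_. borel) (\<lambda>i \<omega>. emeasure (N \<omega>) (A i)) {..<m})"

text \<open>The measures \<open>\<nu>\<^sup>n\<close> and \<open>\<mu>\<^sup>n\<close>: jumps of size less than \<open>1/n\<close> are removed.\<close>

definition trunc_levy :: "nat \<Rightarrow> (real ^ 'd) measure \<Rightarrow> (real ^ 'd) measure" where
  "trunc_levy n \<nu> = density \<nu> (indicator {x. norm x \<ge> 1 / real n})"

definition trunc_jumps ::
  "nat \<Rightarrow> ('w \<Rightarrow> (real \<times> (real ^ 'd)) measure) \<Rightarrow> 'w \<Rightarrow> (real \<times> (real ^ 'd)) measure" where
  "trunc_jumps n \<mu> \<omega> = density (\<mu> \<omega>) (indicator (UNIV \<times> {x. norm x \<ge> 1 / real n}))"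

text \<open>The integral of \<open>H\<close> over \<open>(a,b] \<times> \<real>\<^sup>d\<close> with respect to \<open>\<mu>(ds,dx) - \<nu>(dx)ds\<close>, computed
  path by path. This is meaningful if there are finitely many jumps, as for \<open>\<mu>\<^sup>n\<close> and \<open>\<nu>\<^sup>n\<close>.\<close>

definition pathwise_comp_integral ::
  "('w \<Rightarrow> (real \<times> (real ^ 'd)) measure) \<Rightarrow> (real ^ 'd) measure \<Rightarrow>
   (real \<Rightarrow> 'w \<Rightarrow> real ^ 'd \<Rightarrow> 'b::euclidean_space) \<Rightarrow> real \<Rightarrow> real \<Rightarrow> 'w \<Rightarrow> 'b" where
  "pathwise_comp_integral \<mu> \<nu> H a b \<omega> =
     (LINT p:{a<..b} \<times> UNIV|\<mu> \<omega>. H (fst p) \<omega> (snd p)) -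
     (LINT p:{a<..b} \<times> UNIV|(lborel \<Otimes>\<^sub>M \<nu>). H (fst p) \<omega> (snd p))"

text \<open>The stochastic integral for square-integrable predictable \<open>H\<close>: a random variable \<open>J\<close> is a
  version of \<open>\<integral>\<^bsub>(a,b]\<^esub>\<integral> H\<^sub>s(x) (\<mu>(ds,dx) - \<nu>(dx)ds)\<close> iff it is the \<open>L\<^sup>2\<close> limit of the pathwise
  integrals over the jumps of size at least \<open>1/k\<close>. These are well defined since
  \<open>\<nu> {x. norm x \<ge> 1/k}\<close> is finite, and by the isometry they form an \<open>L\<^sup>2\<close> Cauchy sequence. The
  value is determined up to almost sure equality.\<close>

definition has_comp_integral ::
  "'w measure \<Rightarrow> ('w \<Rightarrow> (real \<times> (real ^ 'd)) measure) \<Rightarrow> (real ^ 'd) measure \<Rightarrow>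
   (real \<Rightarrow> 'w \<Rightarrow> real ^ 'd \<Rightarrow> 'b::euclidean_space) \<Rightarrow> real \<Rightarrow> real \<Rightarrow> ('w \<Rightarrow> 'b) \<Rightarrow> bool" where
  "has_comp_integral M \<mu> \<nu> H a b J \<longleftrightarrow>
     J \<in> borel_measurable M \<and>
     (\<forall>k\<ge>1. pathwise_comp_integral (trunc_jumps k \<mu>) (trunc_levy k \<nu>) H a b \<in> borel_measurable M) \<and>
     (\<lambda>k. \<integral>\<^sup>+ \<omega>. ennreal ((norm (J \<omega> -
          pathwise_comp_integral (trunc_jumps k \<mu>) (trunc_levy k \<nu>) H a b \<omega>))\<^sup>2) \<partial>M)
       \<longlonglongrightarrow> 0"


section \<open>The driving process\<close>

definition levy_process :: "'w measure \<Rightarrow> real \<Rightarrow> (real \<Rightarrow> 'w \<Rightarrow> real ^ 'd) \<Rightarrow> bool" where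
  "levy_process M T X \<longleftrightarrow>
     (\<forall>t\<in>{0..T}. X t \<in> borel_measurable M) \<and>
     (AE \<omega> in M. X 0 \<omega> = 0) \<and>
     (\<forall>\<omega>\<in>space M. cadlag T (\<lambda>t. X t \<omega>)) \<and>
     (\<forall>m (\<tau> :: nat \<Rightarrow> real). \<tau> ` {..m} \<subseteq> {0..T} \<and> mono_on {..m} \<tau> \<longrightarrow>
        prob_space.indep_vars M (\<lambda>_. borel) (\<lambda>i \<omega>. X (\<tau> (Suc i)) \<omega> - X (\<tau> i) \<omega>) {..<m}) \<and>
     (\<forall>s t. 0 \<le> s \<and> s \<le> t \<and> t \<le> T \<longrightarrow>
        distr M borel (\<lambda>\<omega>. X t \<omega> - X s \<omega>) = distr M borel (X (t - s)))"

text \<open>The standing assumptions: \<open>X\<close> is a pure-jump square-integrable Levy martingale on a complete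
  probability space, \<open>X\<^sub>t = \<integral>\<^bsub>(0,t]\<^esub>\<integral> x (\<mu>(ds,dx) - \<nu>(dx)ds)\<close>.\<close>

definition levy_setting ::
  "'w measure \<Rightarrow> real \<Rightarrow> (real \<Rightarrow> 'w \<Rightarrow> real ^ 'd) \<Rightarrow> (real ^ 'd) measure \<Rightarrow> bool" where
  "levy_setting M T X \<nu> \<longleftrightarrow>
     0 < T \<and> prob_space M \<and> complete_measure M \<and>
     levy_measure \<nu> \<and> (\<integral>\<^sup>+ x\<in>{x. norm x \<ge> 1}. ennreal ((norm x)\<^sup>2) \<partial>\<nu>) < \<infinity> \<and>
     levy_process M T X \<and>
     poisson_random_measure M (jump_measure T X) (density lborel (indicator {0<..T}) \<Otimes>\<^sub>M \<nu>) \<and>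
     (\<forall>t\<in>{0..T}. has_comp_integral M (jump_measure T X) \<nu> (\<lambda>s \<omega> x. x) 0 t (X t))"

definition bg_index :: "(real ^ 'd) measure \<Rightarrow> real" where
  "bg_index \<nu> =
     Inf {\<beta>. \<beta> > 0 \<and> (\<integral>\<^sup>+ x\<in>{x. norm x \<le> 1}. ennreal (norm x powr \<beta>) \<partial>\<nu>) < \<infinity>}"

abbreviation levy_filtration ::
  "'w measure \<Rightarrow> real \<Rightarrow> (real \<Rightarrow> 'w \<Rightarrow> real ^ 'd) \<Rightarrow> real \<Rightarrow> 'w measure" where
  "levy_filtration M T X \<equiv> usual_augmentation M T (natural_filtration M X)"

text \<open>\<open>trunc_process n T X \<nu>\<close> is \<open>X\<^sup>n\<close>.\<close>

definition trunc_process ::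
  "nat \<Rightarrow> real \<Rightarrow> (real \<Rightarrow> 'w \<Rightarrow> real ^ 'd) \<Rightarrow> (real ^ 'd) measure \<Rightarrow> real \<Rightarrow> 'w \<Rightarrow> real ^ 'd" where
  "trunc_process n T X \<nu> t =
     pathwise_comp_integral (trunc_jumps n (jump_measure T X)) (trunc_levy n \<nu>) (\<lambda>s \<omega> x. x) 0 t"


section \<open>The backward equations\<close>

text \<open>Elements of \<open>L\<^sup>2(\<nu>)\<close> are represented by functions. A Lipschitz generator takes the same value
  on \<open>\<nu>\<close>-almost everywhere equal functions, hence acts on equivalence classes.\<close>

definition L2_space :: "(real ^ 'd) measure \<Rightarrow> (real ^ 'd \<Rightarrow> real) set" where
  "L2_space \<nu> = {z. z \<in> borel_measurable \<nu> \<and> integrable \<nu> (\<lambda>x. (z x)\<^sup>2)}"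

definition lipschitz_generator ::
  "real \<Rightarrow> (real ^ 'd) measure \<Rightarrow> real \<Rightarrow> (real \<Rightarrow> real \<Rightarrow> (real ^ 'd \<Rightarrow> real) \<Rightarrow> real) \<Rightarrow> bool" where
  "lipschitz_generator T \<nu> L f \<longleftrightarrow>
     (\<forall>t\<in>{0..T}. \<forall>y y'. \<forall>z\<in>L2_space \<nu>. \<forall>z'\<in>L2_space \<nu>.
        \<bar>f t y z - f t y' z'\<bar> \<le> L * (\<bar>y - y'\<bar> + sqrt (\<integral>x. (z x - z' x)\<^sup>2 \<partial>\<nu>)))"

definition sq_integrable_at_zero ::
  "real \<Rightarrow> (real \<Rightarrow> real \<Rightarrow> (real ^ 'd \<Rightarrow> real) \<Rightarrow> real) \<Rightarrow> bool" where
  "sq_integrable_at_zero T f \<longleftrightarrow>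
     set_borel_measurable lebesgue {0..T} (\<lambda>t. f t 0 (\<lambda>_. 0)) \<and>
     set_integrable lebesgue {0..T} (\<lambda>t. (f t 0 (\<lambda>_. 0))\<^sup>2)"

text \<open>The convention \<open>f(t,y,h) = f(t,y,h 1\<^bsub>norm x \<ge> 1/n\<^esub>)\<close> for \<open>h \<in> L\<^sup>2(\<nu>\<^sup>n)\<close>.\<close>

definition large_part :: "nat \<Rightarrow> (real ^ 'd \<Rightarrow> real) \<Rightarrow> real ^ 'd \<Rightarrow> real" where
  "large_part n h = (\<lambda>x. h x * indicator {x. norm x \<ge> 1 / real n} x)"

definition trunc_generator ::
  "nat \<Rightarrow> (real \<Rightarrow> real \<Rightarrow> (real ^ 'd \<Rightarrow> real) \<Rightarrow> real) \<Rightarrow>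
   real \<Rightarrow> real \<Rightarrow> (real ^ 'd \<Rightarrow> real) \<Rightarrow> real" where
  "trunc_generator n f = (\<lambda>t y h. f t y (large_part n h))"

text \<open>Square-integrable solutions of the BSDE with terminal value \<open>\<xi>\<close>. The last conjunct is the
  equation, solved for its stochastic integral and required almost surely for each \<open>t\<close>; since
  \<open>Y\<close> is cadlag this is the same as up to indistinguishability. The generator is evaluated
  along \<open>U\<close>, which lies in \<open>L\<^sup>2(\<nu>)\<close> only for almost every \<open>s\<close>; hence the complete measure
  \<^term>\<open>lebesgue\<close>.\<close>

definition bsde_solution ::
  "'w measure \<Rightarrow> real \<Rightarrow> (real \<Rightarrow> 'w measure) \<Rightarrow> ('w \<Rightarrow> (real \<times> (real ^ 'd)) measure) \<Rightarrow>
   (real ^ 'd) measure \<Rightarrow> (real \<Rightarrow> real \<Rightarrow> (real ^ 'd \<Rightarrow> real) \<Rightarrow> real) \<Rightarrow> ('w \<Rightarrow> real) \<Rightarrow>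
   (real \<Rightarrow> 'w \<Rightarrow> real) \<Rightarrow> (real \<Rightarrow> 'w \<Rightarrow> real ^ 'd \<Rightarrow> real) \<Rightarrow> bool" where
  "bsde_solution M T G \<mu> \<nu> f \<xi> Y U \<longleftrightarrow>
     (\<forall>\<omega>\<in>space M. cadlag T (\<lambda>t. Y t \<omega>)) \<and> adapted T G Y \<and>
     (\<integral>\<^sup>+ \<omega>. (SUP t\<in>{0..T}. ennreal (\<bar>Y t \<omega>\<bar>\<^sup>2)) \<partial>M) < \<infinity> \<and>
     predictable M T G U \<and>
     (\<integral>\<^sup>+ \<omega>. (\<integral>\<^sup>+ t\<in>{0..T}. (\<integral>\<^sup>+ x. ennreal (\<bar>U t \<omega> x\<bar>\<^sup>2) \<partial>\<nu>) \<partial>lborel) \<partial>M) < \<infinity> \<and>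
     (AE \<omega> in M. set_integrable lebesgue {0..T} (\<lambda>s. f s (Y s \<omega>) (U s \<omega>))) \<and>
     (\<forall>t\<in>{0..T}. has_comp_integral M \<mu> \<nu> U t T
        (\<lambda>\<omega>. \<xi> \<omega> + (LINT s:{t..T}|lebesgue. f s (Y s \<omega>) (U s \<omega>)) - Y t \<omega>))"

definition full_bsde_solution ::
  "'w measure \<Rightarrow> real \<Rightarrow> (real \<Rightarrow> 'w \<Rightarrow> real ^ 'd) \<Rightarrow> (real ^ 'd) measure \<Rightarrow>
   (real \<Rightarrow> real \<Rightarrow> (real ^ 'd \<Rightarrow> real) \<Rightarrow> real) \<Rightarrow> ('w \<Rightarrow> real) \<Rightarrow>
   (real \<Rightarrow> 'w \<Rightarrow> real) \<Rightarrow> (real \<Rightarrow> 'w \<Rightarrow> real ^ 'd \<Rightarrow> real) \<Rightarrow> bool" where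
  "full_bsde_solution M T X \<nu> f \<xi> Y U \<longleftrightarrow>
     bsde_solution M T (levy_filtration M T X) (jump_measure T X) \<nu> f \<xi> Y U"

text \<open>The equation driven by \<open>\<mu>\<^sup>n\<close>, relative to the (augmented) filtration generated by \<open>X\<^sup>n\<close>.\<close>

definition trunc_bsde_solution ::
  "nat \<Rightarrow> 'w measure \<Rightarrow> real \<Rightarrow> (real \<Rightarrow> 'w \<Rightarrow> real ^ 'd) \<Rightarrow> (real ^ 'd) measure \<Rightarrow>
   (real \<Rightarrow> real \<Rightarrow> (real ^ 'd \<Rightarrow> real) \<Rightarrow> real) \<Rightarrow> ('w \<Rightarrow> real) \<Rightarrow>
   (real \<Rightarrow> 'w \<Rightarrow> real) \<Rightarrow> (real \<Rightarrow> 'w \<Rightarrow> real ^ 'd \<Rightarrow> real) \<Rightarrow> bool" where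
  "trunc_bsde_solution n M T X \<nu> f \<xi> Y U \<longleftrightarrow>
     bsde_solution M T (levy_filtration M T (trunc_process n T X \<nu>))
       (trunc_jumps n (jump_measure T X)) (trunc_levy n \<nu>) (trunc_generator n f) \<xi> Y U"

definition Y_distance ::
  "'w measure \<Rightarrow> real \<Rightarrow> (real \<Rightarrow> 'w \<Rightarrow> real) \<Rightarrow> (real \<Rightarrow> 'w \<Rightarrow> real) \<Rightarrow> ennreal" where
  "Y_distance M T Y' Y =
     esqrt (\<integral>\<^sup>+ \<omega>. (SUP t\<in>{0..T}. ennreal (\<bar>Y' t \<omega> - Y t \<omega>\<bar>\<^sup>2)) \<partial>M)"

definition U_distance ::
  "'w measure \<Rightarrow> real \<Rightarrow> (real ^ 'd) measure \<Rightarrow> (real \<Rightarrow> 'w \<Rightarrow> real ^ 'd \<Rightarrow> real) \<Rightarrow>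
   (real \<Rightarrow> 'w \<Rightarrow> real ^ 'd \<Rightarrow> real) \<Rightarrow> ennreal" where
  "U_distance M T \<nu> U' U =
     esqrt (\<integral>\<^sup>+ t\<in>{0..T}. (\<integral>\<^sup>+ x. (\<integral>\<^sup>+ \<omega>. ennreal (\<bar>U' t \<omega> x - U t \<omega> x\<bar>\<^sup>2) \<partial>M) \<partial>\<nu>) \<partial>lborel)"

text \<open>\<open>C\<close> is a stability constant for \<open>L\<close> and \<open>T\<close>: one and the same \<open>C\<close> serves every probability
  measure, driving process, Levy measure, generator with Lipschitz constant \<open>L\<close>, truncation level
  and pair of terminal values. The type arguments only name the sample space and the dimension,
  over which HOL cannot quantify.\<close>

definition stability_constant :: "'w itself \<Rightarrow> 'd::finite itself \<Rightarrow> real \<Rightarrow> real \<Rightarrow> real \<Rightarrow> bool" where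
  "stability_constant _ _ L T C \<longleftrightarrow>
     0 \<le> C \<and>
     (\<forall>(M :: 'w measure) (X :: real \<Rightarrow> 'w \<Rightarrow> real ^ 'd) \<nu> f n \<xi> \<xi>n Y U Y\<^sub>n U\<^sub>n.
        levy_setting M T X \<nu> \<and> lipschitz_generator T \<nu> L f \<and> sq_integrable_at_zero T f \<and> 1 \<le> n \<and>
        \<xi> \<in> borel_measurable (levy_filtration M T X T) \<and>
        (\<integral>\<^sup>+ \<omega>. ennreal (\<bar>\<xi> \<omega>\<bar>\<^sup>2) \<partial>M) < \<infinity> \<and>
        \<xi>n \<in> borel_measurable (levy_filtration M T (trunc_process n T X \<nu>) T) \<and>
        (\<integral>\<^sup>+ \<omega>. ennreal (\<bar>\<xi>n \<omega>\<bar>\<^sup>2) \<partial>M) < \<infinity> \<and>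
        full_bsde_solution M T X \<nu> f \<xi> Y U \<and> trunc_bsde_solution n M T X \<nu> f \<xi>n Y\<^sub>n U\<^sub>n
        \<longrightarrow>
        Y_distance M T Y\<^sub>n Y
          \<le> ennreal C * esqrt (\<integral>\<^sup>+ \<omega>. ennreal (\<bar>\<xi>n \<omega> - \<xi> \<omega>\<bar>\<^sup>2) \<partial>M) \<and>
        U_distance M T \<nu> (\<lambda>t \<omega>. large_part n (U\<^sub>n t \<omega>)) U
          \<le> ennreal C * esqrt (\<integral>\<^sup>+ \<omega>. ennreal (\<bar>\<xi>n \<omega> - \<xi> \<omega>\<bar>\<^sup>2) \<partial>M))"

end

theory Submission
  imports Defs
begin

text \<open>
  The stability constant reduces everything to the terminal values: both distances are at most
  \<open>C\<close> times the \<open>L\<^sup>2\<close>-distance of \<open>g(X\<^sup>n\<^sub>T)\<close> and \<open>g(X\<^sub>T)\<close>, which by the Lipschitz condition is at most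
  \<open>L\<^sub>g\<close> times that of \<open>X\<^sup>n\<^sub>T\<close> and \<open>X\<^sub>T\<close>. What has to be shown is that
  \<open>E |X\<^sub>T - X\<^sup>n\<^sub>T|\<^sup>2\<close> is at most \<open>4 T n powr (\<beta> - 2) \<integral> norm x powr \<beta> d\<nu>\<close>, and that the terminal values are
  admissible, that is, square-integrable and measurable for their filtrations.

  The difference \<open>X\<^sub>T - X\<^sup>n\<^sub>T\<close> is the compensated sum of the jumps smaller than \<open>1/n\<close>, and by the isometry of
  compensated Poisson integrals its second moment is \<open>T\<close> times the integral of \<open>(norm x)\<^sup>2\<close> over
  \<open>norm x < 1/n\<close>. There \<open>(norm x)\<^sup>2 \<le> norm x powr \<beta> * n powr (\<beta> - 2)\<close>, and \<open>norm x powr \<beta>\<close> is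
  \<open>\<nu>\<close>-integrable as \<open>\<beta>\<close> exceeds the Blumenthal--Getoor index.

  The isometry is derived from the definition of a Poisson random measure. Counts of disjoint
  sets are independent with variance equal to the intensity, which gives equality for step functions
  (\<open>compensated_isometry_simple\<close>); Fatou's lemma extends it as an inequality to all integrable functions
  (\<open>compensated_isometry_le\<close>). That inequality covers the differences \<open>X\<^sup>m\<^sub>T - X\<^sup>n\<^sub>T\<close>, whose jumps
  are bounded away from zero; the limit \<open>m \<rightarrow> \<infinity>\<close> is the definition of the stochastic integral \<open>X\<^sub>T\<close>
  (\<open>truncation_error\<close>).
\<close>

section \<open>Moments of the Poisson distribution\<close>

text \<open>
  The Poisson distribution with mean \<open>l\<close> is characterised by \<open>E[K h(K)] = l E[h(K + 1)]\<close>; this is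
  that identity, an index shift in the series. Applied to \<open>h = 1\<close> and \<open>h(k) = k\<close> it yields the first two
  moments, without a case distinction for \<open>l = 0\<close>.
\<close>

lemma poisson_sums_shift:
  fixes l :: real and h :: "nat \<Rightarrow> real"
  assumes "(\<lambda>k. h (Suc k) * (l ^ k / fact k * exp (- l))) sums s"
  shows "(\<lambda>k. real k * h k * (l ^ k / fact k * exp (- l))) sums (l * s)"
proof -
  have "real (Suc k) * h (Suc k) * (l ^ Suc k / fact (Suc k) * exp (- l))
      = l * (h (Suc k) * (l ^ k / fact k * exp (- l)))" for k
    by (simp add: divide_simps del: of_nat_Suc)
  then have "(\<lambda>k. real (Suc k) * h (Suc k) * (l ^ Suc k / fact (Suc k) * exp (- l))) sums (l * s)"
    using sums_mult[OF assms, of l] by presburger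
  from sums_Suc[OF this] show ?thesis by simp
qed

lemma poisson_sums_1: "(\<lambda>k. l ^ k / fact k * exp (- l)) sums (1::real)"
proof -
  have "(\<lambda>k. l ^ k / fact k) sums exp l"
    using exp_converges[of l] by (simp add: divide_inverse mult.commute)
  from sums_mult2[OF this, of "exp (- l)"] show ?thesis
    by (simp add: exp_minus_inverse)
qed

lemma poisson_sums_mean: "(\<lambda>k. real k * (l ^ k / fact k * exp (- l))) sums (l::real)"
  using poisson_sums_shift[of "\<lambda>_. 1" l 1] poisson_sums_1[of l] by simp

lemma poisson_sums_variance: "(\<lambda>k. (real k - l)\<^sup>2 * (l ^ k / fact k * exp (- l))) sums (l::real)"
proof -
  let ?p = "\<lambda>k. l ^ k / fact k * exp (- l)"
  have "(\<lambda>k. real (Suc k) * ?p k) sums (l + 1)"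
    using sums_add[OF poisson_sums_mean poisson_sums_1, of l l] by (simp add: algebra_simps add_divide_distrib)
  then have *: "(\<lambda>k. real k * real k * ?p k) sums (l * (l + 1))"
    by (rule poisson_sums_shift)
  have "(\<lambda>k. real k * real k * ?p k - 2 * l * (real k * ?p k) + l\<^sup>2 * ?p k) sums (l * (l + 1) - 2 * l * l + l\<^sup>2 * 1)"
    by (intro sums_add sums_diff sums_mult * poisson_sums_mean poisson_sums_1)
  then show ?thesis
    by (simp add: power2_eq_square algebra_simps add_divide_distrib)
qed

section \<open>Second moments\<close>

lemma norm_add_square_le:
  fixes a b :: "'b::real_normed_vector"
  shows "(norm (a + b))\<^sup>2 \<le> 2 * (norm a)\<^sup>2 + 2 * (norm b)\<^sup>2"
proof -
  have "(norm (a + b))\<^sup>2 \<le> (norm a + norm b)\<^sup>2"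
    by (intro power_mono norm_triangle_ineq) simp
  also have "\<dots> \<le> 2 * (norm a)\<^sup>2 + 2 * (norm b)\<^sup>2"
    using zero_le_power2[of "norm a - norm b"] by (simp add: power2_eq_square algebra_simps)
  finally show ?thesis .
qed

lemma nn_integral_norm_add_square_le:
  fixes V W :: "'a \<Rightarrow> 'b::euclidean_space"
  assumes [measurable]: "V \<in> borel_measurable M" "W \<in> borel_measurable M"
  shows "(\<integral>\<^sup>+ \<omega>. ennreal ((norm (V \<omega> + W \<omega>))\<^sup>2) \<partial>M)
    \<le> 2 * (\<integral>\<^sup>+ \<omega>. ennreal ((norm (V \<omega>))\<^sup>2) \<partial>M) + 2 * (\<integral>\<^sup>+ \<omega>. ennreal ((norm (W \<omega>))\<^sup>2) \<partial>M)"
proof -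
  have "(\<integral>\<^sup>+ \<omega>. ennreal ((norm (V \<omega> + W \<omega>))\<^sup>2) \<partial>M)
      \<le> (\<integral>\<^sup>+ \<omega>. 2 * ennreal ((norm (V \<omega>))\<^sup>2) + 2 * ennreal ((norm (W \<omega>))\<^sup>2) \<partial>M)"
  proof (rule nn_integral_mono)
    fix \<omega>
    show "ennreal ((norm (V \<omega> + W \<omega>))\<^sup>2) \<le> 2 * ennreal ((norm (V \<omega>))\<^sup>2) + 2 * ennreal ((norm (W \<omega>))\<^sup>2)"
      using ennreal_leI[OF norm_add_square_le[of "V \<omega>" "W \<omega>"]] by (simp add: ennreal_mult')
  qed
  also have "\<dots> = 2 * (\<integral>\<^sup>+ \<omega>. ennreal ((norm (V \<omega>))\<^sup>2) \<partial>M) + 2 * (\<integral>\<^sup>+ \<omega>. ennreal ((norm (W \<omega>))\<^sup>2) \<partial>M)"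
    by (simp add: nn_integral_add nn_integral_cmult)
  finally show ?thesis .
qed

text \<open>
  Pythagoras for random coefficients that are pairwise orthogonal in \<open>L\<^sup>2\<close>: the mixed terms of the
  expanded square vanish in expectation, whatever the vectors \<open>c i\<close> are.
\<close>

lemma (in prob_space) expectation_norm_square_orthogonal:
  fixes D :: "'i \<Rightarrow> 'a \<Rightarrow> real" and c :: "'i \<Rightarrow> 'b::euclidean_space"
  assumes "finite I"
    and int: "\<And>i j. i \<in> I \<Longrightarrow> j \<in> I \<Longrightarrow> integrable M (\<lambda>\<omega>. D i \<omega> * D j \<omega>)"
    and orth: "\<And>i j. i \<in> I \<Longrightarrow> j \<in> I \<Longrightarrow> i \<noteq> j \<Longrightarrow> (\<integral>\<omega>. D i \<omega> * D j \<omega> \<partial>M) = 0"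
  shows "integrable M (\<lambda>\<omega>. (norm (\<Sum>i\<in>I. D i \<omega> *\<^sub>R c i))\<^sup>2)" (is ?int)
    and "(\<integral>\<omega>. (norm (\<Sum>i\<in>I. D i \<omega> *\<^sub>R c i))\<^sup>2 \<partial>M)
      = (\<Sum>i\<in>I. (\<integral>\<omega>. D i \<omega> * D i \<omega> \<partial>M) * (norm (c i))\<^sup>2)" (is ?eq)
proof -
  have *: "(norm (\<Sum>i\<in>I. D i \<omega> *\<^sub>R c i))\<^sup>2 = (\<Sum>i\<in>I. \<Sum>j\<in>I. (D i \<omega> * D j \<omega>) * (c i \<bullet> c j))" for \<omega>
    by (simp add: power2_norm_eq_inner inner_sum_left inner_sum_right sum_distrib_left mult.assoc)
       (simp add: inner_commute)
  show ?int
    unfolding * by (intro Bochner_Integration.integrable_sum integrable_mult_left int)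
  have "(\<integral>\<omega>. (norm (\<Sum>i\<in>I. D i \<omega> *\<^sub>R c i))\<^sup>2 \<partial>M)
      = (\<Sum>i\<in>I. \<Sum>j\<in>I. (\<integral>\<omega>. D i \<omega> * D j \<omega> \<partial>M) * (c i \<bullet> c j))"
    unfolding * by (simp add: int)
  also have "\<dots> = (\<Sum>i\<in>I. \<Sum>j\<in>I. if j = i then (\<integral>\<omega>. D i \<omega> * D i \<omega> \<partial>M) * (c i \<bullet> c i) else 0)"
    by (intro sum.cong refl) (auto simp: orth)
  finally show ?eq
    using \<open>finite I\<close> by (simp add: power2_norm_eq_inner)
qed

lemma (in prob_space) lipschitz_square_integrable:
  fixes g :: "'b::euclidean_space \<Rightarrow> real" and Z :: "'a \<Rightarrow> 'b"
  assumes lip: "\<And>x x'. \<bar>g x - g x'\<bar> \<le> L * norm (x - x')"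
    and Z: "Z \<in> borel_measurable M" "(\<integral>\<^sup>+ \<omega>. ennreal ((norm (Z \<omega>))\<^sup>2) \<partial>M) < \<infinity>"
  shows "(\<integral>\<^sup>+ \<omega>. ennreal (\<bar>g (Z \<omega>)\<bar>\<^sup>2) \<partial>M) < \<infinity>"
proof -
  have "(\<integral>\<^sup>+ \<omega>. ennreal (\<bar>g (Z \<omega>)\<bar>\<^sup>2) \<partial>M)
      \<le> (\<integral>\<^sup>+ \<omega>. ennreal (2 * (g 0)\<^sup>2) + ennreal (2 * L\<^sup>2) * ennreal ((norm (Z \<omega>))\<^sup>2) \<partial>M)"
  proof (rule nn_integral_mono)
    fix \<omega>
    have "(g (Z \<omega>) - g 0)\<^sup>2 \<le> (L * norm (Z \<omega>))\<^sup>2"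
      using power_mono[OF lip[of "Z \<omega>" 0], of 2] by simp
    then have "\<bar>g (Z \<omega>)\<bar>\<^sup>2 \<le> 2 * (g 0)\<^sup>2 + 2 * L\<^sup>2 * (norm (Z \<omega>))\<^sup>2"
      using norm_add_square_le[of "g 0" "g (Z \<omega>) - g 0"] by (simp add: power_mult_distrib)
    then show "ennreal (\<bar>g (Z \<omega>)\<bar>\<^sup>2) \<le> ennreal (2 * (g 0)\<^sup>2) + ennreal (2 * L\<^sup>2) * ennreal ((norm (Z \<omega>))\<^sup>2)"
      by (simp add: ennreal_leI flip: ennreal_mult' ennreal_plus)
  qed
  also have "\<dots> = ennreal (2 * (g 0)\<^sup>2) + ennreal (2 * L\<^sup>2) * (\<integral>\<^sup>+ \<omega>. ennreal ((norm (Z \<omega>))\<^sup>2) \<partial>M)"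
    using Z(1) by (simp add: nn_integral_add nn_integral_cmult emeasure_space_1)
  also have "\<dots> < \<infinity>"
    using Z(2) by (simp add: ennreal_mult_less_top)
  finally show ?thesis .
qed

lemma esqrt_le:
  assumes "a \<le> ennreal (b\<^sup>2)" "0 \<le> b"
  shows "esqrt a \<le> ennreal b"
proof -
  have "a < \<infinity>" using assms(1) by (auto simp: le_less_trans)
  moreover have "enn2real a \<le> b\<^sup>2"
    using enn2real_mono[OF assms(1)] by simp
  then have "sqrt (enn2real a) \<le> b"
    using assms(2) by (simp add: real_le_lsqrt)
  ultimately show ?thesis
    by (auto simp: esqrt_def intro!: ennreal_leI)
qed

section \<open>Compensated integrals against Poisson random measures\<close>

locale poisson_measure = prob_space M
  for M :: "'w measure" and N :: "'w \<Rightarrow> 'e measure" and \<Lambda> :: "'e measure" +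
  assumes prm: "poisson_random_measure M N \<Lambda>"
begin

lemma sets_N: "\<omega> \<in> space M \<Longrightarrow> sets (N \<omega>) = sets \<Lambda>"
  using prm by (simp add: poisson_random_measure_def)

lemma space_N: "\<omega> \<in> space M \<Longrightarrow> space (N \<omega>) = space \<Lambda>"
  using sets_N sets_eq_imp_space_eq by blast

lemma measurable_N: "\<omega> \<in> space M \<Longrightarrow> borel_measurable (N \<omega>) = borel_measurable \<Lambda>"
  using sets_N by (intro measurable_cong_sets) auto

lemma simple_function_N: "\<omega> \<in> space M \<Longrightarrow> simple_function (N \<omega>) s = simple_function \<Lambda> s"
  by (simp add: simple_function_def sets_N space_N)

lemma measurable_count[measurable]:
  "A \<in> sets \<Lambda> \<Longrightarrow> (\<lambda>\<omega>. emeasure (N \<omega>) A) \<in> borel_measurable M"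
  using prm by (simp add: poisson_random_measure_def)

lemma prob_count:
  assumes "A \<in> sets \<Lambda>" "emeasure \<Lambda> A < \<infinity>"
  shows "prob {\<omega> \<in> space M. emeasure (N \<omega>) A = of_nat k}
    = measure \<Lambda> A ^ k / fact k * exp (- measure \<Lambda> A)"
  using prm assms by (simp add: poisson_random_measure_def)

text \<open>
  The Poisson probabilities sum to one, so a count with finite intensity almost surely takes one of
  the values \<open>0, 1, 2, \<dots>\<close>, although a priori it is only an extended nonnegative number. All moments of
  counts are therefore series.
\<close>

lemma nn_integral_count:
  fixes h :: "ennreal \<Rightarrow> ennreal"
  assumes A[measurable]: "A \<in> sets \<Lambda>" "emeasure \<Lambda> A < \<infinity>"
    and [measurable]: "h \<in> borel_measurable borel"
  shows "(\<integral>\<^sup>+ \<omega>. h (emeasure (N \<omega>) A) \<partial>M)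
    = (\<Sum>k. h (of_nat k) * ennreal (measure \<Lambda> A ^ k / fact k * exp (- measure \<Lambda> A)))"
proof -
  let ?E = "\<lambda>k. {\<omega> \<in> space M. emeasure (N \<omega>) A = of_nat k}"
  have disj: "disjoint_family ?E"
    by (auto simp: disjoint_family_on_def)
  have "prob (\<Union>k. ?E k) = (\<Sum>k. prob (?E k))"
    by (intro sums_unique finite_measure_UNION disj) auto
  also have "\<dots> = 1"
    using poisson_sums_1 by (simp add: prob_count[OF A] sums_iff)
  finally have "AE \<omega> in M. \<omega> \<in> (\<Union>k. ?E k)"
    by (intro AE_prob_1)
  then have "AE \<omega> in M. h (emeasure (N \<omega>) A) = (\<Sum>k. h (of_nat k) * indicator (?E k) \<omega>)"
  proof eventually_elim
    case (elim \<omega>)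
    then obtain j where j: "\<omega> \<in> ?E j" by auto
    \<comment> \<open>The events are disjoint, so a single term of the series survives.\<close>
    then have "indicator (?E k) \<omega> = (if k = j then 1 else 0 :: ennreal)" for k
      by (auto simp: indicator_def)
    then have "(\<lambda>k. h (of_nat k) * indicator (?E k) \<omega>) = (\<lambda>k. if k = j then h (of_nat j) else 0)"
      by auto
    moreover have "(\<Sum>k. if k = j then h (of_nat j) else 0) = h (of_nat j)"
      using sums_single[of j "\<lambda>_. h (of_nat j)"] by (simp add: sums_iff)
    ultimately show ?case using j by simp
  qed
  then have "(\<integral>\<^sup>+ \<omega>. h (emeasure (N \<omega>) A) \<partial>M) = (\<integral>\<^sup>+ \<omega>. (\<Sum>k. h (of_nat k) * indicator (?E k) \<omega>) \<partial>M)"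
    by (rule nn_integral_cong_AE)
  also have "\<dots> = (\<Sum>k. \<integral>\<^sup>+ \<omega>. h (of_nat k) * indicator (?E k) \<omega> \<partial>M)"
    by (intro nn_integral_suminf) measurable
  also have "\<dots> = (\<Sum>k. h (of_nat k) * emeasure M (?E k))"
    by (intro suminf_cong nn_integral_cmult_indicator) measurable
  finally show ?thesis
    by (simp add: emeasure_eq_measure prob_count[OF A])
qed

lemma nn_integral_count_eq:
  assumes A[measurable]: "A \<in> sets \<Lambda>"
  shows "(\<integral>\<^sup>+ \<omega>. emeasure (N \<omega>) A \<partial>M) = emeasure \<Lambda> A"
proof (cases "emeasure \<Lambda> A = \<infinity>")
  case True
  then have "AE \<omega> in M. emeasure (N \<omega>) A = \<infinity>"
    using prm A by (simp add: poisson_random_measure_def)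
  then have "(\<integral>\<^sup>+ \<omega>. emeasure (N \<omega>) A \<partial>M) = (\<integral>\<^sup>+ \<omega>. \<infinity> \<partial>M)"
    by (rule nn_integral_cong_AE)
  then show ?thesis
    by (simp add: True emeasure_space_1)
next
  case False
  then have fin: "emeasure \<Lambda> A < \<infinity>" by (simp add: less_top)
  let ?p = "\<lambda>k. measure \<Lambda> A ^ k / fact k * exp (- measure \<Lambda> A)"
  have "(\<integral>\<^sup>+ \<omega>. emeasure (N \<omega>) A \<partial>M) = (\<Sum>k. ennreal (real k * ?p k))"
    by (subst nn_integral_count[OF A fin, of "\<lambda>x. x"])
       (simp_all add: ennreal_of_nat_eq_real_of_nat flip: ennreal_mult')
  also have "\<dots> = ennreal (measure \<Lambda> A)"
    by (intro suminf_ennreal_eq poisson_sums_mean) simp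
  finally show ?thesis
    using False by (simp add: emeasure_eq_ennreal_measure)
qed

lemma AE_count_finite:
  assumes [measurable]: "A \<in> sets \<Lambda>" and "emeasure \<Lambda> A < \<infinity>"
  shows "AE \<omega> in M. emeasure (N \<omega>) A < \<infinity>"
  using nn_integral_PInf_AE[of "\<lambda>\<omega>. emeasure (N \<omega>) A" M] assms
  by (auto simp: nn_integral_count_eq less_top)

definition centred :: "'e set \<Rightarrow> 'w \<Rightarrow> real" where
  "centred A \<omega> = measure (N \<omega>) A - measure \<Lambda> A"

lemma measurable_centred[measurable]:
  "A \<in> sets \<Lambda> \<Longrightarrow> centred A \<in> borel_measurable M"
  unfolding centred_def[abs_def] measure_def
  by (intro borel_measurable_diff borel_measurable_const
      borel_measurable_enn2real measurable_count)

lemma centred_square: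
  assumes A[measurable]: "A \<in> sets \<Lambda>" and fin: "emeasure \<Lambda> A < \<infinity>"
  shows "integrable M (\<lambda>\<omega>. centred A \<omega> * centred A \<omega>)"
    and "(\<integral>\<omega>. centred A \<omega> * centred A \<omega> \<partial>M) = measure \<Lambda> A"
proof -
  let ?p = "\<lambda>k. measure \<Lambda> A ^ k / fact k * exp (- measure \<Lambda> A)"
  have *: "(\<integral>\<^sup>+ \<omega>. ennreal (centred A \<omega> * centred A \<omega>) \<partial>M) = (\<Sum>k. ennreal ((real k - measure \<Lambda> A)\<^sup>2 * ?p k))"
  proof -
    have "(\<integral>\<^sup>+ \<omega>. ennreal (centred A \<omega> * centred A \<omega>) \<partial>M)
        = (\<Sum>k. ennreal ((enn2real (of_nat k) - measure \<Lambda> A)\<^sup>2) * ennreal (?p k))"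
      unfolding centred_def measure_def[of "N _"] power2_eq_square[symmetric]
      by (rule nn_integral_count[OF A fin]) measurable
    also have "\<dots> = (\<Sum>k. ennreal ((real k - measure \<Lambda> A)\<^sup>2 * ?p k))"
      by (intro suminf_cong) (simp only: ennreal_mult' zero_le_power2 enn2real_of_nat)
    finally show ?thesis .
  qed
  also have "\<dots> = ennreal (measure \<Lambda> A)"
    by (intro suminf_ennreal_eq poisson_sums_variance) simp
  finally have *: "(\<integral>\<^sup>+ \<omega>. ennreal (centred A \<omega> * centred A \<omega>) \<partial>M) = ennreal (measure \<Lambda> A)" .
  show "integrable M (\<lambda>\<omega>. centred A \<omega> * centred A \<omega>)"
    by (rule integrableI_nonneg) (auto simp: *)
  show "(\<integral>\<omega>. centred A \<omega> * centred A \<omega> \<partial>M) = measure \<Lambda> A"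
    by (rule integral_eq_nn_integral[THEN trans]) (auto simp: *)
qed

lemma centred_mean:
  assumes A[measurable]: "A \<in> sets \<Lambda>" and fin: "emeasure \<Lambda> A < \<infinity>"
  shows "integrable M (centred A)" and "(\<integral>\<omega>. centred A \<omega> \<partial>M) = 0"
proof -
  have "(\<integral>\<^sup>+ \<omega>. ennreal (measure (N \<omega>) A) \<partial>M) = (\<integral>\<^sup>+ \<omega>. emeasure (N \<omega>) A \<partial>M)"
    using AE_count_finite[OF A fin]
    by (intro nn_integral_cong_AE) (auto simp: emeasure_eq_ennreal_measure)
  also have "\<dots> = ennreal (measure \<Lambda> A)"
    using fin by (simp add: nn_integral_count_eq[OF A] emeasure_eq_ennreal_measure less_top)
  finally have "has_bochner_integral M (\<lambda>\<omega>. measure (N \<omega>) A) (measure \<Lambda> A)"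
    by (intro has_bochner_integral_nn_integral) (auto simp: measure_def)
  then have "has_bochner_integral M (\<lambda>\<omega>. measure (N \<omega>) A - measure \<Lambda> A) (measure \<Lambda> A - measure \<Lambda> A)"
    by (intro has_bochner_integral_diff)
       (auto simp: has_bochner_integral_iff prob_space)
  then show "integrable M (centred A)" and "(\<integral>\<omega>. centred A \<omega> \<partial>M) = 0"
    by (auto simp: has_bochner_integral_iff centred_def[abs_def])
qed

lemma centred_uncorrelated:
  assumes A: "A \<in> sets \<Lambda>" "emeasure \<Lambda> A < \<infinity>" and B: "B \<in> sets \<Lambda>" "emeasure \<Lambda> B < \<infinity>"
    and "A \<inter> B = {}"
  shows "integrable M (\<lambda>\<omega>. centred A \<omega> * centred B \<omega>)"
    and "(\<integral>\<omega>. centred A \<omega> * centred B \<omega> \<partial>M) = 0"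
proof -
  define F where "F i = (if i = (0::nat) then A else B)" for i
  have F: "F i \<in> sets \<Lambda>" "emeasure \<Lambda> (F i) < \<infinity>" for i
    using A B by (auto simp: F_def)
  have "(\<forall>i<2. F i \<in> sets \<Lambda>) \<and> disjoint_family_on F {..<2}"
    using F \<open>A \<inter> B = {}\<close> by (auto simp: disjoint_family_on_def F_def)
  then have "indep_vars (\<lambda>_. borel) (\<lambda>i \<omega>. emeasure (N \<omega>) (F i)) {..<2}"
    using prm unfolding poisson_random_measure_def by blast
  then have ind: "indep_vars (\<lambda>_. borel) (\<lambda>i \<omega>. enn2real (emeasure (N \<omega>) (F i)) - measure \<Lambda> (F i)) {..<2}"
    by (rule indep_vars_compose2) measurable
  then have ind: "indep_vars (\<lambda>_. borel) (\<lambda>i. centred (F i)) {..<2}"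
    by (simp add: centred_def[abs_def] measure_def)
  have eq: "(\<Prod>i<2. centred (F i) \<omega>) = centred A \<omega> * centred B \<omega>" for \<omega>
    by (simp add: F_def numeral_2_eq_2)
  show "integrable M (\<lambda>\<omega>. centred A \<omega> * centred B \<omega>)"
    using indep_vars_integrable[OF _ ind] centred_mean(1)[OF F] by (simp add: eq)
  show "(\<integral>\<omega>. centred A \<omega> * centred B \<omega> \<partial>M) = 0"
    using indep_vars_lebesgue_integral[OF _ ind] centred_mean[OF F] by (simp add: eq)
qed

text \<open>
  Campbell's formula. Measurability of \<open>\<omega> \<mapsto> \<integral> h dN(\<omega>)\<close> has to be carried through the same induction,
  because \<open>N\<close> is only known to be measurable through the counts of single sets.
\<close>

lemma campbell:
  assumes "h \<in> borel_measurable \<Lambda>"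
  shows "(\<lambda>\<omega>. \<integral>\<^sup>+ e. h e \<partial>N \<omega>) \<in> borel_measurable M \<and>
    (\<integral>\<^sup>+ \<omega>. (\<integral>\<^sup>+ e. h e \<partial>N \<omega>) \<partial>M) = (\<integral>\<^sup>+ e. h e \<partial>\<Lambda>)"
  using assms
proof (induction h rule: borel_measurable_induct)
  case (cong f g)
  have "(\<integral>\<^sup>+ e. f e \<partial>N \<omega>) = (\<integral>\<^sup>+ e. g e \<partial>N \<omega>)" if "\<omega> \<in> space M" for \<omega>
    using cong that by (intro nn_integral_cong) (auto simp: space_N)
  moreover have "(\<integral>\<^sup>+ e. f e \<partial>\<Lambda>) = (\<integral>\<^sup>+ e. g e \<partial>\<Lambda>)"
    using cong by (intro nn_integral_cong) auto
  ultimately show ?case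
    using cong by (simp cong: measurable_cong nn_integral_cong)
next
  case (set A)
  then have "(\<integral>\<^sup>+ e. indicator A e \<partial>N \<omega>) = emeasure (N \<omega>) A" if "\<omega> \<in> space M" for \<omega>
    using that by (simp add: sets_N)
  then show ?case
    using set by (simp add: nn_integral_count_eq cong: measurable_cong nn_integral_cong)
next
  case (mult u c)
  then have "(\<integral>\<^sup>+ e. c * u e \<partial>N \<omega>) = c * (\<integral>\<^sup>+ e. u e \<partial>N \<omega>)" if "\<omega> \<in> space M" for \<omega>
    using that by (intro nn_integral_cmult) (simp add: measurable_N)
  moreover have "(\<lambda>\<omega>. c * (\<integral>\<^sup>+ e. u e \<partial>N \<omega>)) \<in> borel_measurable M"
    using mult by (intro borel_measurable_times_ennreal) auto
  ultimately show ?case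
    using mult by (simp add: nn_integral_cmult cong: measurable_cong nn_integral_cong)
next
  case (add u v)
  then have "(\<integral>\<^sup>+ e. v e + u e \<partial>N \<omega>) = (\<integral>\<^sup>+ e. v e \<partial>N \<omega>) + (\<integral>\<^sup>+ e. u e \<partial>N \<omega>)" if "\<omega> \<in> space M" for \<omega>
    using that by (intro nn_integral_add) (auto simp add: measurable_N)
  moreover have "(\<lambda>\<omega>. (\<integral>\<^sup>+ e. v e \<partial>N \<omega>) + (\<integral>\<^sup>+ e. u e \<partial>N \<omega>)) \<in> borel_measurable M"
    using add by (intro borel_measurable_add) auto
  ultimately show ?case
    using add by (simp add: nn_integral_add cong: measurable_cong nn_integral_cong)
next
  case (seq U)
  have sup: "(SUP i. U i) = (\<lambda>e. SUP i. U i e)"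
    by (rule ext) (rule SUP_apply)
  have eq: "(\<integral>\<^sup>+ e. (SUP i. U i e) \<partial>N \<omega>) = (SUP i. \<integral>\<^sup>+ e. U i e \<partial>N \<omega>)" if "\<omega> \<in> space M" for \<omega>
    using that seq.hyps(1) by (intro nn_integral_monotone_convergence_SUP \<open>incseq U\<close>) (simp add: measurable_N)
  have inc: "incseq (\<lambda>i \<omega>. \<integral>\<^sup>+ e. U i e \<partial>N \<omega>)"
    using \<open>incseq U\<close> by (auto simp: incseq_def le_fun_def intro!: nn_integral_mono)
  have "(\<lambda>\<omega>. SUP i. \<integral>\<^sup>+ e. U i e \<partial>N \<omega>) \<in> borel_measurable M"
    using seq.IH by (intro borel_measurable_SUP) auto
  moreover have "(\<integral>\<^sup>+ \<omega>. (SUP i. \<integral>\<^sup>+ e. U i e \<partial>N \<omega>) \<partial>M) = (SUP i. \<integral>\<^sup>+ \<omega>. (\<integral>\<^sup>+ e. U i e \<partial>N \<omega>) \<partial>M)"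
    by (intro nn_integral_monotone_convergence_SUP inc) (use seq.IH in blast)
  moreover have "(SUP i. \<integral>\<^sup>+ \<omega>. (\<integral>\<^sup>+ e. U i e \<partial>N \<omega>) \<partial>M) = (\<integral>\<^sup>+ e. (SUP i. U i e) \<partial>\<Lambda>)"
    using seq.IH nn_integral_monotone_convergence_SUP[OF \<open>incseq U\<close> seq.hyps(1)] by simp
  ultimately show ?case
    unfolding sup by (simp add: eq cong: measurable_cong nn_integral_cong)
qed

text \<open>
  By Campbell's formula the integral of \<open>norm \<phi>\<close> against \<open>N\<close> has a finite expectation, hence is almost
  surely finite.
\<close>

lemma AE_integrable_N:
  fixes \<phi> :: "'e \<Rightarrow> 'b::euclidean_space"
  assumes "integrable \<Lambda> \<phi>"
  shows "AE \<omega> in M. integrable (N \<omega>) \<phi>"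
proof -
  have [measurable]: "\<phi> \<in> borel_measurable \<Lambda>" using assms by simp
  let ?h = "\<lambda>e. ennreal (norm (\<phi> e))"
  have C: "(\<lambda>\<omega>. \<integral>\<^sup>+ e. ?h e \<partial>N \<omega>) \<in> borel_measurable M"
    "(\<integral>\<^sup>+ \<omega>. (\<integral>\<^sup>+ e. ?h e \<partial>N \<omega>) \<partial>M) = (\<integral>\<^sup>+ e. ?h e \<partial>\<Lambda>)"
    using campbell[of ?h] by auto
  have "AE \<omega> in M. (\<integral>\<^sup>+ e. ?h e \<partial>N \<omega>) \<noteq> \<infinity>"
    using assms by (intro nn_integral_PInf_AE C) (auto simp: C integrable_iff_bounded)
  then show ?thesis
    by (auto simp: integrable_iff_bounded measurable_N less_top)
qed

text \<open>
  For a step function the compensated integral is the finite sum of the values times the centred counts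
  of their level sets. These are disjoint, so the centred counts are orthogonal with variances equal to the
  intensities, and the second moment is the integral of the squared norm.

  The second claim replaces the compensated integral, whose measurability is not available directly, by
  this finite sum.
\<close>

lemma compensated_isometry_simple:
  fixes s :: "'e \<Rightarrow> 'b::euclidean_space"
  assumes sf: "simple_function \<Lambda> s" and supp: "emeasure \<Lambda> {e \<in> space \<Lambda>. s e \<noteq> 0} < \<infinity>"
  shows "(\<integral>\<^sup>+ \<omega>. ennreal ((norm ((\<integral>e. s e \<partial>N \<omega>) - (\<integral>e. s e \<partial>\<Lambda>)))\<^sup>2) \<partial>M)
    = (\<integral>\<^sup>+ e. ennreal ((norm (s e))\<^sup>2) \<partial>\<Lambda>)"
    and "\<exists>Z\<in>borel_measurable M. AE \<omega> in M. (\<integral>e. s e \<partial>N \<omega>) - (\<integral>e. s e \<partial>\<Lambda>) = Z \<omega>"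
proof -
  \<comment> \<open>The value 0 is left out, as its level set may have infinite intensity.\<close>
  define V where "V = s ` space \<Lambda> - {0}"
  define A where "A c = {e \<in> space \<Lambda>. s e = c}" for c
  have [measurable]: "s \<in> borel_measurable \<Lambda>"
    using sf by (rule borel_measurable_simple_function)
  have V: "finite V"
    using sf by (simp add: V_def simple_function_def)
  have A[measurable]: "A c \<in> sets \<Lambda>" for c
    unfolding A_def by measurable
  have Afin: "emeasure \<Lambda> (A c) < \<infinity>" if "c \<in> V" for c
  proof -
    have "emeasure \<Lambda> (A c) \<le> emeasure \<Lambda> {e \<in> space \<Lambda>. s e \<noteq> 0}"
      using that by (intro emeasure_mono) (auto simp: A_def V_def)
    then show ?thesis using supp by (rule le_less_trans)
  qed
  have integral_s: "(\<integral>e. s e \<partial>Q) = (\<Sum>c\<in>V. measure Q (A c) *\<^sub>R c)"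
    if Q: "Bochner_Integration.simple_bochner_integrable Q s" "space Q = space \<Lambda>" for Q
  proof -
    have "(\<integral>e. s e \<partial>Q) = (\<Sum>c\<in>s ` space \<Lambda>. measure Q (A c) *\<^sub>R c)"
      using has_bochner_integral_simple_bochner_integrable[OF Q(1)] Q(2)
      by (simp add: has_bochner_integral_iff simple_bochner_integral_def A_def)
    also have "\<dots> = (\<Sum>c\<in>V. measure Q (A c) *\<^sub>R c)"
      using sf by (intro sum.mono_neutral_right) (auto simp: V_def simple_function_def)
    finally show ?thesis .
  qed
  have "AE \<omega> in M. emeasure (N \<omega>) {e \<in> space \<Lambda>. s e \<noteq> 0} < \<infinity>"
    by (intro AE_count_finite supp) measurable
  then have AE: "AE \<omega> in M. (\<integral>e. s e \<partial>N \<omega>) - (\<integral>e. s e \<partial>\<Lambda>) = (\<Sum>c\<in>V. centred (A c) \<omega> *\<^sub>R c)"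
  proof (rule AE_mp, intro AE_I2 impI)
    fix \<omega> assume \<omega>: "\<omega> \<in> space M" and fin: "emeasure (N \<omega>) {e \<in> space \<Lambda>. s e \<noteq> 0} < \<infinity>"
    have "Bochner_Integration.simple_bochner_integrable (N \<omega>) s" "Bochner_Integration.simple_bochner_integrable \<Lambda> s"
      using \<omega> fin sf supp by (auto intro!: simple_bochner_integrable.intros simp: simple_function_N space_N)
    then show "(\<integral>e. s e \<partial>N \<omega>) - (\<integral>e. s e \<partial>\<Lambda>) = (\<Sum>c\<in>V. centred (A c) \<omega> *\<^sub>R c)"
      using \<omega> by (simp add: integral_s space_N centred_def scaleR_diff_left sum_subtractf)
  qed
  show "\<exists>Z\<in>borel_measurable M. AE \<omega> in M. (\<integral>e. s e \<partial>N \<omega>) - (\<integral>e. s e \<partial>\<Lambda>) = Z \<omega>"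
    using AE by (intro bexI[of _ "\<lambda>\<omega>. \<Sum>c\<in>V. centred (A c) \<omega> *\<^sub>R c"]) auto
  have int: "integrable M (\<lambda>\<omega>. centred (A c) \<omega> * centred (A d) \<omega>)"
    and orth: "c \<noteq> d \<Longrightarrow> (\<integral>\<omega>. centred (A c) \<omega> * centred (A d) \<omega> \<partial>M) = 0"
    if "c \<in> V" "d \<in> V" for c d
  proof -
    have disj: "A c \<inter> A d = {}" if "c \<noteq> d"
      using that by (auto simp: A_def)
    note uncorrelated = centred_uncorrelated[OF A Afin A Afin disj, OF \<open>c \<in> V\<close> \<open>d \<in> V\<close>]
    show "integrable M (\<lambda>\<omega>. centred (A c) \<omega> * centred (A d) \<omega>)"
      using uncorrelated(1) centred_square(1)[OF A Afin[OF \<open>c \<in> V\<close>]] by (cases "c = d") blast+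
    show "c \<noteq> d \<Longrightarrow> (\<integral>\<omega>. centred (A c) \<omega> * centred (A d) \<omega> \<partial>M) = 0"
      by (rule uncorrelated(2))
  qed
  note orthogonal = expectation_norm_square_orthogonal[OF V int orth, where c = "\<lambda>c. c"]
  have "(\<integral>\<^sup>+ \<omega>. ennreal ((norm ((\<integral>e. s e \<partial>N \<omega>) - (\<integral>e. s e \<partial>\<Lambda>)))\<^sup>2) \<partial>M)
      = (\<integral>\<^sup>+ \<omega>. ennreal ((norm (\<Sum>c\<in>V. centred (A c) \<omega> *\<^sub>R c))\<^sup>2) \<partial>M)"
    using AE by (intro nn_integral_cong_AE) auto
  also have "\<dots> = ennreal (\<integral>\<omega>. (norm (\<Sum>c\<in>V. centred (A c) \<omega> *\<^sub>R c))\<^sup>2 \<partial>M)"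
    by (rule nn_integral_eq_integral) (auto intro: orthogonal(1))
  also have "\<dots> = ennreal (\<Sum>c\<in>V. measure \<Lambda> (A c) * (norm c)\<^sup>2)"
    by (subst orthogonal(2)) (auto simp: centred_square[OF A Afin])
  also have "\<dots> = (\<Sum>c\<in>V. emeasure \<Lambda> (A c) * ennreal ((norm c)\<^sup>2))"
    using Afin by (subst sum_ennreal[symmetric]) (auto simp: ennreal_mult emeasure_eq_ennreal_measure less_top intro!: sum.cong)
  also have "\<dots> = (\<integral>\<^sup>+ e. (\<Sum>c\<in>V. ennreal ((norm c)\<^sup>2) * indicator (A c) e) \<partial>\<Lambda>)"
    by (subst nn_integral_sum) (auto simp: nn_integral_cmult_indicator mult.commute[of "emeasure \<Lambda> _"])
  also have "\<dots> = (\<integral>\<^sup>+ e. ennreal ((norm (s e))\<^sup>2) \<partial>\<Lambda>)"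
  proof (rule nn_integral_cong)
    fix e assume e: "e \<in> space \<Lambda>"
    have "(\<Sum>c\<in>V. ennreal ((norm c)\<^sup>2) * indicator (A c) e)
        = (\<Sum>c\<in>V. if c = s e then ennreal ((norm c)\<^sup>2) else 0)"
    proof (intro sum.cong refl)
      fix c show "ennreal ((norm c)\<^sup>2) * indicator (A c) e = (if c = s e then ennreal ((norm c)\<^sup>2) else 0)"
        using e unfolding A_def by (cases "c = s e") simp_all
    qed
    also have "\<dots> = (if s e \<in> V then ennreal ((norm (s e))\<^sup>2) else 0)"
      by (rule sum.delta[OF V])
    also have "\<dots> = ennreal ((norm (s e))\<^sup>2)"
      using e unfolding V_def by (cases "s e = 0") simp_all
    finally show "(\<Sum>c\<in>V. ennreal ((norm c)\<^sup>2) * indicator (A c) e) = ennreal ((norm (s e))\<^sup>2)" .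
  qed
  finally show "(\<integral>\<^sup>+ \<omega>. ennreal ((norm ((\<integral>e. s e \<partial>N \<omega>) - (\<integral>e. s e \<partial>\<Lambda>)))\<^sup>2) \<partial>M)
    = (\<integral>\<^sup>+ e. ennreal ((norm (s e))\<^sup>2) \<partial>\<Lambda>)" .
qed

text \<open>
  Approximate \<open>\<phi>\<close> pointwise by step functions \<open>s i\<close> with \<open>norm (s i) \<le> 2 * norm \<phi>\<close>. Dominated convergence
  applies to the integrals against \<open>N(\<omega>)\<close> for almost every \<open>\<omega>\<close>, so Fatou's lemma passes the isometry of
  step functions to the limit. Fatou gives only an inequality, but it works for
  unbounded \<open>\<phi>\<close>, such as the jump size on \<open>norm x \<ge> 1/n\<close>.
\<close>

lemma compensated_isometry_le:
  fixes \<phi> :: "'e \<Rightarrow> 'b::euclidean_space"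
  assumes \<phi>: "integrable \<Lambda> \<phi>"
  shows "(\<integral>\<^sup>+ \<omega>. ennreal ((norm ((\<integral>e. \<phi> e \<partial>N \<omega>) - (\<integral>e. \<phi> e \<partial>\<Lambda>)))\<^sup>2) \<partial>M)
    \<le> (\<integral>\<^sup>+ e. ennreal ((norm (\<phi> e))\<^sup>2) \<partial>\<Lambda>)"
proof (cases "(\<integral>\<^sup>+ e. ennreal ((norm (\<phi> e))\<^sup>2) \<partial>\<Lambda>) < \<infinity>")
  case True
  have [measurable]: "\<phi> \<in> borel_measurable \<Lambda>" using \<phi> by simp
  obtain s where s: "\<And>i. simple_function \<Lambda> (s i)"
    and lim: "\<And>e. e \<in> space \<Lambda> \<Longrightarrow> (\<lambda>i. s i e) \<longlonglongrightarrow> \<phi> e"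
    and bnd: "\<And>i e. e \<in> space \<Lambda> \<Longrightarrow> norm (s i e) \<le> 2 * norm (\<phi> e)"
    using borel_measurable_implies_sequence_metric[of \<phi> \<Lambda> 0] by (simp add: dist_norm) metis
  have [measurable]: "s i \<in> borel_measurable \<Lambda>" for i
    using s by (rule borel_measurable_simple_function)
  have supp: "emeasure \<Lambda> {e \<in> space \<Lambda>. s i e \<noteq> 0} < \<infinity>" for i
  proof -
    have "integrable \<Lambda> (s i)"
      by (rule Bochner_Integration.integrable_bound[OF integrable_mult_right[OF integrable_norm[OF \<phi>], of 2]])
         (auto simp: bnd)
    then have "Bochner_Integration.simple_bochner_integrable \<Lambda> (s i)"
      using s by (intro simple_bochner_integrableI_bounded) (auto simp: integrable_iff_bounded)
    then show ?thesis
      by (simp add: simple_bochner_integrable.simps less_top)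
  qed
  let ?D = "\<lambda>\<phi> \<omega>. (\<integral>e. \<phi> e \<partial>N \<omega>) - (\<integral>e. \<phi> e \<partial>\<Lambda>)"
  have "\<forall>i. \<exists>Z\<in>borel_measurable M. AE \<omega> in M. ?D (s i) \<omega> = Z \<omega>"
    using compensated_isometry_simple(2)[OF s supp] by blast
  then obtain Z where [measurable]: "\<And>i. Z i \<in> borel_measurable M"
    and Z: "\<And>i. AE \<omega> in M. ?D (s i) \<omega> = Z i \<omega>"
    by metis
  have "AE \<omega> in M. (\<lambda>i. ?D (s i) \<omega>) \<longlonglongrightarrow> ?D \<phi> \<omega>"
    using AE_integrable_N[OF \<phi>]
  proof (rule AE_mp, intro AE_I2 impI tendsto_diff)
    fix \<omega> assume \<omega>: "\<omega> \<in> space M" and int: "integrable (N \<omega>) \<phi>"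
    show "(\<lambda>i. \<integral>e. s i e \<partial>N \<omega>) \<longlonglongrightarrow> (\<integral>e. \<phi> e \<partial>N \<omega>)"
      by (rule integral_dominated_convergence[where w = "\<lambda>e. 2 * norm (\<phi> e)"])
         (use \<omega> int lim bnd in \<open>auto simp: measurable_N space_N\<close>)
    show "(\<lambda>i. \<integral>e. s i e \<partial>\<Lambda>) \<longlonglongrightarrow> (\<integral>e. \<phi> e \<partial>\<Lambda>)"
      by (rule integral_dominated_convergence[where w = "\<lambda>e. 2 * norm (\<phi> e)"])
         (use \<phi> lim bnd in auto)
  qed
  moreover have "AE \<omega> in M. \<forall>i. ?D (s i) \<omega> = Z i \<omega>"
    using Z by (simp add: AE_all_countable)
  ultimately have "AE \<omega> in M. ennreal ((norm (?D \<phi> \<omega>))\<^sup>2) = liminf (\<lambda>i. ennreal ((norm (Z i \<omega>))\<^sup>2))"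
  proof eventually_elim
    case (elim \<omega>)
    then have "(\<lambda>i. ennreal ((norm (Z i \<omega>))\<^sup>2)) \<longlonglongrightarrow> ennreal ((norm (?D \<phi> \<omega>))\<^sup>2)"
      by (intro tendsto_intros) simp
    from lim_imp_Liminf[OF sequentially_bot this] show ?case
      by (rule sym)
  qed
  then have "(\<integral>\<^sup>+ \<omega>. ennreal ((norm (?D \<phi> \<omega>))\<^sup>2) \<partial>M)
      = (\<integral>\<^sup>+ \<omega>. liminf (\<lambda>i. ennreal ((norm (Z i \<omega>))\<^sup>2)) \<partial>M)"
    by (rule nn_integral_cong_AE)
  also have "\<dots> \<le> liminf (\<lambda>i. \<integral>\<^sup>+ \<omega>. ennreal ((norm (Z i \<omega>))\<^sup>2) \<partial>M)"
    by (rule nn_integral_liminf) measurable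
  also have "(\<lambda>i. \<integral>\<^sup>+ \<omega>. ennreal ((norm (Z i \<omega>))\<^sup>2) \<partial>M) = (\<lambda>i. \<integral>\<^sup>+ e. ennreal ((norm (s i e))\<^sup>2) \<partial>\<Lambda>)"
  proof
    fix i
    have "(\<integral>\<^sup>+ \<omega>. ennreal ((norm (Z i \<omega>))\<^sup>2) \<partial>M) = (\<integral>\<^sup>+ \<omega>. ennreal ((norm (?D (s i) \<omega>))\<^sup>2) \<partial>M)"
      using Z[of i] by (intro nn_integral_cong_AE) auto
    then show "(\<integral>\<^sup>+ \<omega>. ennreal ((norm (Z i \<omega>))\<^sup>2) \<partial>M) = (\<integral>\<^sup>+ e. ennreal ((norm (s i e))\<^sup>2) \<partial>\<Lambda>)"
      by (simp only: compensated_isometry_simple(1)[OF s supp])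
  qed
  also have "liminf (\<lambda>i. \<integral>\<^sup>+ e. ennreal ((norm (s i e))\<^sup>2) \<partial>\<Lambda>) = (\<integral>\<^sup>+ e. ennreal ((norm (\<phi> e))\<^sup>2) \<partial>\<Lambda>)"
  proof (intro lim_imp_Liminf)
    show "(\<lambda>i. \<integral>\<^sup>+ e. ennreal ((norm (s i e))\<^sup>2) \<partial>\<Lambda>) \<longlonglongrightarrow> (\<integral>\<^sup>+ e. ennreal ((norm (\<phi> e))\<^sup>2) \<partial>\<Lambda>)"
    proof (rule nn_integral_dominated_convergence[where w = "\<lambda>e. 4 * ennreal ((norm (\<phi> e))\<^sup>2)"])
      have "(norm (s i e))\<^sup>2 \<le> 4 * (norm (\<phi> e))\<^sup>2" if "e \<in> space \<Lambda>" for i e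
        using power_mono[OF bnd[OF that, of i], of 2] by (simp add: power_mult_distrib)
      from ennreal_leI[OF this]
      show "AE e in \<Lambda>. ennreal ((norm (s i e))\<^sup>2) \<le> 4 * ennreal ((norm (\<phi> e))\<^sup>2)" for i
        by (intro AE_I2) (simp add: ennreal_mult')
      show "(\<integral>\<^sup>+ e. 4 * ennreal ((norm (\<phi> e))\<^sup>2) \<partial>\<Lambda>) < \<infinity>"
        using True by (simp add: nn_integral_cmult ennreal_mult_less_top)
      show "AE e in \<Lambda>. (\<lambda>i. ennreal ((norm (s i e))\<^sup>2)) \<longlonglongrightarrow> ennreal ((norm (\<phi> e))\<^sup>2)"
        using lim by (intro AE_I2 tendsto_intros) auto
    qed measurable
  qed simp
  finally show ?thesis .
qed (simp add: not_less top_unique)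

end

section \<open>Terminal values of the driving process and of its truncations\<close>

text \<open>
  The preimages of Borel sets under \<open>Z T\<close> generate part of the filtration at time \<open>T\<close>, and augmentation
  keeps them: for every \<open>u > T\<close> the \<open>\<sigma>\<close>-algebra at time \<open>min u T = T\<close> contains them. The bookkeeping
  consists in showing that all families passed to \<^const>\<open>sigma\<close> consist of subsets of the sample space, as
  \<^const>\<open>sigma\<close> is a default value otherwise.
\<close>

lemma measurable_usual_augmentation_terminal:
  fixes Z :: "real \<Rightarrow> 'w \<Rightarrow> 'b::topological_space"
  assumes "0 \<le> T"
  shows "Z T \<in> borel_measurable (usual_augmentation M T (natural_filtration M Z) T)"
proof (rule measurableI)
  let ?G = "natural_filtration M Z T"
  have nat: "{Z s -` A \<inter> space M |s A. s \<in> {0..T} \<and> A \<in> sets borel} \<subseteq> Pow (space M)"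
    by auto
  have space_F: "space (natural_filtration M Z t) = space M" for t
    by (simp add: natural_filtration_def space_measure_of_conv)
  have pow: "sets (natural_filtration M Z t) \<union> null_sets M \<subseteq> Pow (space M)" for t
    using sets.sets_into_space[of _ M] sets.sets_into_space[of _ "natural_filtration M Z t"]
    unfolding space_F by auto
  let ?R = "\<Inter>u\<in>{T<..}. sets (sigma (space M) (sets (natural_filtration M Z (min u T)) \<union> null_sets M))"
  \<comment> \<open>Any \<open>u > T\<close> would do, as all of them are cut off at \<open>T\<close>.\<close>
  have "?R \<subseteq> sets (sigma (space M) (sets ?G \<union> null_sets M))"
    by (rule INF_lower2[of "T + 1"]) auto
  then have R: "?R \<subseteq> Pow (space M)"
    using sets.sets_into_space[of _ "sigma (space M) (sets ?G \<union> null_sets M)"]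
    by (auto simp: space_measure_of_conv)
  fix A :: "'b set" assume "A \<in> sets borel"
  then have "Z T -` A \<inter> space M \<in> sets ?G"
    unfolding natural_filtration_def sets_measure_of[OF nat]
    using assms by (intro sigma_sets.Basic) auto
  then have "Z T -` A \<inter> space M \<in> ?R"
    unfolding sets_measure_of[OF pow] by (auto intro!: sigma_sets.Basic simp: min_def)
  then show "Z T -` A \<inter> space (usual_augmentation M T (natural_filtration M Z) T)
      \<in> sets (usual_augmentation M T (natural_filtration M Z) T)"
    unfolding usual_augmentation_def sets_measure_of[OF R]
    by (auto simp: space_measure_of_conv intro: sigma_sets.Basic)
qed simp

lemma integral_density_indicator:
  fixes \<phi> :: "'e \<Rightarrow> 'b::euclidean_space"
  assumes "A \<in> sets Q" "\<phi> \<in> borel_measurable Q"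
  shows "(\<integral>e. \<phi> e \<partial>density Q (indicator A)) = (\<integral>e. indicator A e *\<^sub>R \<phi> e \<partial>Q)"
proof -
  have "density Q (indicator A) = density Q (\<lambda>e. ennreal (indicator A e))"
    by (simp add: ennreal_indicator)
  then show ?thesis
    using assms by (simp add: integral_density)
qed

locale levy_martingale =
  fixes M :: "'w measure" and T :: real and X :: "real \<Rightarrow> 'w \<Rightarrow> real ^ 'd" and \<nu> :: "(real ^ 'd) measure"
  assumes setting: "levy_setting M T X \<nu>"
begin

definition intensity :: "(real \<times> (real ^ 'd)) measure" where
  "intensity = density lborel (indicator {0<..T}) \<Otimes>\<^sub>M \<nu>"

text \<open>
  The time interval is part of the function so that \<open>X\<^sup>n\<^sub>T\<close> becomes an integral over the whole space, against
  \<open>\<mu>\<close> itself and against its intensity, for every truncation level \<open>n\<close>.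
\<close>

definition large_jump :: "nat \<Rightarrow> real \<times> (real ^ 'd) \<Rightarrow> real ^ 'd" where
  "large_jump n p = indicator ({0<..T} \<times> {x. norm x \<ge> 1 / real n}) p *\<^sub>R snd p"

lemma T_pos: "0 < T"
  using setting by (simp add: levy_setting_def)

sublocale poisson_measure M "jump_measure T X" intensity
  using setting
  by (simp add: poisson_measure_def poisson_measure_axioms_def levy_setting_def intensity_def)

lemma sets_nu[measurable_cong]: "sets \<nu> = sets borel"
  using setting by (simp add: levy_setting_def levy_measure_def)

lemma space_nu: "space \<nu> = UNIV"
  using sets_eq_imp_space_eq[OF sets_nu] by simp

lemma nn_integral_norm_square: "(\<integral>\<^sup>+ x. ennreal ((norm x)\<^sup>2) \<partial>\<nu>) < \<infinity>"
proof -
  have "(\<integral>\<^sup>+ x. ennreal ((norm x)\<^sup>2) \<partial>\<nu>)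
      \<le> (\<integral>\<^sup>+ x. ennreal (min 1 ((norm x)\<^sup>2)) + ennreal ((norm x)\<^sup>2) * indicator {x. norm x \<ge> 1} x \<partial>\<nu>)"
  proof (rule nn_integral_mono)
    fix x :: "real ^ 'd"
    show "ennreal ((norm x)\<^sup>2) \<le> ennreal (min 1 ((norm x)\<^sup>2)) + ennreal ((norm x)\<^sup>2) * indicator {x. norm x \<ge> 1} x"
    proof (cases "norm x \<ge> 1")
      case False
      then have "(norm x)\<^sup>2 \<le> 1" by (simp add: power_le_one)
      then show ?thesis using False by (simp add: min_def)
    qed simp
  qed
  also have "\<dots> = (\<integral>\<^sup>+ x. ennreal (min 1 ((norm x)\<^sup>2)) \<partial>\<nu>) + (\<integral>\<^sup>+ x\<in>{x. norm x \<ge> 1}. ennreal ((norm x)\<^sup>2) \<partial>\<nu>)"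
    by (intro nn_integral_add) measurable
  also have "\<dots> < \<infinity>"
    using setting by (simp add: levy_setting_def levy_measure_def)
  finally show ?thesis .
qed

lemma emeasure_large_jumps_finite:
  assumes "0 < r"
  shows "emeasure \<nu> {x. norm x \<ge> r} < \<infinity>"
proof -
  have "emeasure \<nu> {x. norm x \<ge> r} = (\<integral>\<^sup>+ x. indicator {x. norm x \<ge> r} x \<partial>\<nu>)"
    by (rule nn_integral_indicator[symmetric]) measurable
  also have "\<dots> \<le> (\<integral>\<^sup>+ x. ennreal (1 / r\<^sup>2) * ennreal ((norm x)\<^sup>2) \<partial>\<nu>)"
  proof (rule nn_integral_mono)
    fix x :: "real ^ 'd"
    show "indicator {x. norm x \<ge> r} x \<le> ennreal (1 / r\<^sup>2) * ennreal ((norm x)\<^sup>2)"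
    proof (cases "norm x \<ge> r")
      case True
      then have "1 \<le> 1 / r\<^sup>2 * (norm x)\<^sup>2"
        using assms power_mono[OF True, of 2] by (simp add: field_simps)
      then show ?thesis using True
        by (simp flip: ennreal_mult' ennreal_1 del: ennreal_1)
    qed simp
  qed
  also have "\<dots> < \<infinity>"
    using nn_integral_norm_square by (subst nn_integral_cmult) (auto simp: ennreal_mult_less_top)
  finally show ?thesis .
qed

text \<open>
  The sets \<open>{x. norm x \<ge> 1/k}\<close> have finite measure by Chebyshev's inequality and exhaust everything but the
  origin, which is a null set of a Levy measure.
\<close>

lemma sigma_finite_nu: "sigma_finite_measure \<nu>"
proof
  let ?B = "\<lambda>k::nat. {x :: real ^ 'd. norm x \<ge> 1 / Suc k}"
  have "x \<in> (\<Union>k. ?B k)" if "x \<noteq> 0" for x :: "real ^ 'd"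
  proof -
    obtain k where "inverse (real (Suc k)) < norm x"
      using \<open>x \<noteq> 0\<close> reals_Archimedean[of "norm x"] by (auto simp del: of_nat_Suc)
    then show ?thesis
      by (auto intro!: exI[of _ k] simp: inverse_eq_divide)
  qed
  then have "\<Union>(insert {0} (range ?B)) = space \<nu>"
    by (auto simp: space_nu)
  moreover have "insert {0} (range ?B) \<subseteq> sets \<nu>"
    unfolding sets_nu by auto
  moreover have "emeasure \<nu> {0} \<noteq> \<infinity>"
    using setting by (simp add: levy_setting_def levy_measure_def)
  moreover have "emeasure \<nu> (?B k) \<noteq> \<infinity>" for k
    using emeasure_large_jumps_finite[of "1 / Suc k"] by simp
  ultimately show "\<exists>A. countable A \<and> A \<subseteq> sets \<nu> \<and> \<Union> A = space \<nu> \<and> (\<forall>a\<in>A. emeasure \<nu> a \<noteq> \<infinity>)"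
    by (intro exI[of _ "insert {0} (range ?B)"]) auto
qed

text \<open>
  The intensity of \<open>\<mu>\<close> restricts time, the compensator of \<open>\<mu>\<^sup>n\<close> restricts the jump size. Both are
  densities of the one measure \<^term>\<open>lborel \<Otimes>\<^sub>M \<nu>\<close>, which makes their integrals comparable.
\<close>

lemma intensity_eq_density:
  "intensity = density (lborel \<Otimes>\<^sub>M \<nu>) (indicator ({0<..T} \<times> UNIV))"
proof -
  interpret sigma_finite_measure \<nu> by (rule sigma_finite_nu)
  have "intensity = density lborel (indicator {0<..T}) \<Otimes>\<^sub>M density \<nu> (\<lambda>_. 1)"
    by (simp add: intensity_def density_1)
  also have "\<dots> = density (lborel \<Otimes>\<^sub>M \<nu>) (\<lambda>(t, x). indicator {0<..T} t * 1)"
    by (intro pair_measure_density) (auto simp: density_1 sigma_finite_nu)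
  also have "(\<lambda>(t, x). indicator {0<..T} t * 1 :: ennreal) = indicator ({0<..T} \<times> UNIV)"
    by (auto simp: fun_eq_iff indicator_def)
  finally show ?thesis .
qed

lemma lborel_trunc_levy_eq_density:
  "lborel \<Otimes>\<^sub>M trunc_levy n \<nu> = density (lborel \<Otimes>\<^sub>M \<nu>) (indicator (UNIV \<times> {x. norm x \<ge> 1 / real n}))"
proof -
  have sf: "sigma_finite_measure (trunc_levy n \<nu>)"
    unfolding trunc_levy_def
    by (subst sigma_finite_measure.sigma_finite_iff_density_finite[OF sigma_finite_nu])
       (auto simp: indicator_def)
  have "lborel \<Otimes>\<^sub>M trunc_levy n \<nu> = density lborel (\<lambda>_. 1) \<Otimes>\<^sub>M trunc_levy n \<nu>"
    by (simp add: density_1)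
  also have "\<dots> = density (lborel \<Otimes>\<^sub>M \<nu>) (\<lambda>(t, x). 1 * indicator {x. norm x \<ge> 1 / real n} x)"
    unfolding trunc_levy_def
    by (intro pair_measure_density sigma_finite_nu sf[unfolded trunc_levy_def]) measurable
  also have "(\<lambda>(t, x). 1 * indicator {x. norm x \<ge> 1 / real n} x :: ennreal) = indicator (UNIV \<times> {x. norm x \<ge> 1 / real n})"
    by (auto simp: fun_eq_iff indicator_def)
  finally show ?thesis .
qed

lemma nn_integral_intensity:
  assumes [measurable]: "h \<in> borel_measurable borel"
  shows "(\<integral>\<^sup>+ p. h (snd p) \<partial>intensity) = ennreal T * (\<integral>\<^sup>+ x. h x \<partial>\<nu>)"
proof -
  interpret sigma_finite_measure \<nu> by (rule sigma_finite_nu)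
  have "(\<integral>\<^sup>+ p. h (snd p) \<partial>intensity) = (\<integral>\<^sup>+ t. \<integral>\<^sup>+ x. h x \<partial>\<nu> \<partial>density lborel (indicator {0<..T}))"
    unfolding intensity_def by (subst nn_integral_fst[symmetric]) auto
  also have "\<dots> = ennreal T * (\<integral>\<^sup>+ x. h x \<partial>\<nu>)"
    using T_pos by (simp add: emeasure_density mult.commute)
  finally show ?thesis .
qed

lemma sets_intensity[measurable_cong]: "sets intensity = sets (borel \<Otimes>\<^sub>M borel)"
  unfolding intensity_def by (intro sets_pair_measure_cong) (auto simp: sets_nu)

lemma measurable_large_jump[measurable]:
  "large_jump n \<in> borel_measurable (borel \<Otimes>\<^sub>M borel)"
  unfolding large_jump_def[abs_def] by measurable

text \<open>
  On the support one has \<open>norm x \<le> n * (norm x)\<^sup>2\<close>, so the second moment of \<open>\<nu>\<close> controls the first.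
\<close>

lemma integrable_large_jump:
  assumes "1 \<le> n"
  shows "integrable intensity (large_jump n)"
proof (rule integrableI_bounded)
  have "(\<integral>\<^sup>+ p. ennreal (norm (large_jump n p)) \<partial>intensity)
      \<le> (\<integral>\<^sup>+ p. ennreal n * ennreal ((norm (snd p))\<^sup>2) \<partial>intensity)"
  proof (rule nn_integral_mono)
    fix p :: "real \<times> (real ^ 'd)"
    have "norm (snd p) \<le> n * (norm (snd p))\<^sup>2" if "norm (snd p) \<ge> 1 / n"
    proof -
      have "1 * norm (snd p) \<le> (n * norm (snd p)) * norm (snd p)"
        using that assms by (intro mult_right_mono) (auto simp: field_simps)
      then show ?thesis by (simp add: power2_eq_square mult.assoc)
    qed
    then have "norm (large_jump n p) \<le> n * (norm (snd p))\<^sup>2"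
      by (auto simp: large_jump_def indicator_def)
    then show "ennreal (norm (large_jump n p)) \<le> ennreal n * ennreal ((norm (snd p))\<^sup>2)"
      by (simp add: ennreal_leI flip: ennreal_mult')
  qed
  also have "\<dots> < \<infinity>"
    using nn_integral_norm_square
    by (subst nn_integral_intensity) (auto simp: nn_integral_cmult ennreal_mult_less_top)
  finally show "(\<integral>\<^sup>+ p. ennreal (norm (large_jump n p)) \<partial>intensity) < \<infinity>" .
qed measurable

text \<open>
  \<open>X\<^sup>n\<^sub>T\<close> is defined by integrals against truncated measures; moving the truncation from the
  measures into the integrand writes all \<open>X\<^sup>n\<^sub>T\<close> as compensated integrals against one and the same Poisson
  random measure, so that they can be subtracted.
\<close>

lemma trunc_process_terminal:
  "trunc_process n T X \<nu> T \<omega>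
    = (\<integral>p. large_jump n p \<partial>jump_measure T X \<omega>) - (\<integral>p. large_jump n p \<partial>intensity)"
proof -
  let ?I = "\<lambda>Q. LINT p:{0<..T} \<times> UNIV|density Q (indicator (UNIV \<times> {x. norm x \<ge> 1 / real n})). snd p"
  let ?L = "\<lambda>Q :: (real \<times> (real ^ 'd)) measure. \<integral>p. large_jump n p \<partial>Q"
  have *: "?I Q = ?L Q" if Q: "sets Q = sets (borel \<Otimes>\<^sub>M borel)" for Q
  proof -
    have "(\<lambda>p. indicator ({0<..T} \<times> UNIV) p *\<^sub>R snd p :: real ^ 'd) \<in> borel_measurable (borel \<Otimes>\<^sub>M borel)"
      by measurable
    then have "?I Q = (\<integral>p. indicator (UNIV \<times> {x. norm x \<ge> 1 / real n}) p *\<^sub>R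
        (indicator ({0<..T} \<times> UNIV) p *\<^sub>R snd p) \<partial>Q)"
      unfolding set_lebesgue_integral_def measurable_cong_sets[OF Q[symmetric] refl]
      by (intro integral_density_indicator) (auto simp: Q)
    also have "\<dots> = ?L Q"
      by (rule Bochner_Integration.integral_cong) (auto simp: large_jump_def indicator_def)
    finally show ?thesis .
  qed
  have sets_prod: "sets (lborel \<Otimes>\<^sub>M \<nu>) = sets (borel \<Otimes>\<^sub>M borel)"
    by (intro sets_pair_measure_cong) (simp_all add: sets_nu)
  have "?L intensity = (\<integral>p. indicator ({0<..T} \<times> UNIV) p *\<^sub>R large_jump n p \<partial>(lborel \<Otimes>\<^sub>M \<nu>))"
    unfolding intensity_eq_density using measurable_large_jump
    by (intro integral_density_indicator)
       (auto simp: sets_prod measurable_cong_sets[OF sets_prod refl])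
  also have "\<dots> = ?L (lborel \<Otimes>\<^sub>M \<nu>)"
    by (rule Bochner_Integration.integral_cong) (auto simp: large_jump_def indicator_def)
  also have "\<dots> = ?I (lborel \<Otimes>\<^sub>M \<nu>)"
    by (rule *[OF sets_prod, symmetric])
  also have "\<dots> = (LINT p:{0<..T} \<times> UNIV|(lborel \<Otimes>\<^sub>M trunc_levy n \<nu>). snd p)"
    by (simp only: lborel_trunc_levy_eq_density)
  finally have "?L intensity = (LINT p:{0<..T} \<times> UNIV|(lborel \<Otimes>\<^sub>M trunc_levy n \<nu>). snd p)" .
  then show ?thesis
    unfolding trunc_process_def pathwise_comp_integral_def trunc_jumps_def
    by (simp add: * jump_measure_def)
qed

lemma second_moment_trunc_process:
  assumes "1 \<le> n"
  shows "(\<integral>\<^sup>+ \<omega>. ennreal ((norm (trunc_process n T X \<nu> T \<omega>))\<^sup>2) \<partial>M) < \<infinity>"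
proof -
  have "(\<integral>\<^sup>+ \<omega>. ennreal ((norm (trunc_process n T X \<nu> T \<omega>))\<^sup>2) \<partial>M)
      \<le> (\<integral>\<^sup>+ p. ennreal ((norm (large_jump n p))\<^sup>2) \<partial>intensity)"
    unfolding trunc_process_terminal by (rule compensated_isometry_le[OF integrable_large_jump[OF assms]])
  also have "\<dots> \<le> (\<integral>\<^sup>+ p. ennreal ((norm (snd p))\<^sup>2) \<partial>intensity)"
    by (intro nn_integral_mono) (auto simp: large_jump_def indicator_def)
  also have "\<dots> < \<infinity>"
    using nn_integral_norm_square by (subst nn_integral_intensity) (auto simp: ennreal_mult_less_top)
  finally show ?thesis .
qed

text \<open>
  The difference is the compensated integral over the jumps with \<open>1/m \<le> norm x < 1/n\<close>. The bound does not
  depend on \<open>m\<close>, which is what the passage to \<open>X\<^sub>T\<close> needs.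
\<close>

lemma trunc_process_difference:
  assumes "1 \<le> n" "n \<le> m"
  shows "(\<integral>\<^sup>+ \<omega>. ennreal ((norm (trunc_process m T X \<nu> T \<omega> - trunc_process n T X \<nu> T \<omega>))\<^sup>2) \<partial>M)
    \<le> ennreal T * (\<integral>\<^sup>+ x\<in>{x. norm x < 1 / real n}. ennreal ((norm x)\<^sup>2) \<partial>\<nu>)"
proof -
  let ?\<phi> = "\<lambda>p. large_jump m p - large_jump n p"
  have "1 \<le> m" using assms by simp
  note int = integrable_large_jump[OF \<open>1 \<le> m\<close>] integrable_large_jump[OF \<open>1 \<le> n\<close>]
  have "AE \<omega> in M. trunc_process m T X \<nu> T \<omega> - trunc_process n T X \<nu> T \<omega>
      = (\<integral>p. ?\<phi> p \<partial>jump_measure T X \<omega>) - (\<integral>p. ?\<phi> p \<partial>intensity)"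
    using AE_integrable_N[OF int(1)] AE_integrable_N[OF int(2)]
    by eventually_elim (simp add: trunc_process_terminal int)
  then have "(\<integral>\<^sup>+ \<omega>. ennreal ((norm (trunc_process m T X \<nu> T \<omega> - trunc_process n T X \<nu> T \<omega>))\<^sup>2) \<partial>M)
      = (\<integral>\<^sup>+ \<omega>. ennreal ((norm ((\<integral>p. ?\<phi> p \<partial>jump_measure T X \<omega>) - (\<integral>p. ?\<phi> p \<partial>intensity)))\<^sup>2) \<partial>M)"
    by (intro nn_integral_cong_AE) auto
  also have "\<dots> \<le> (\<integral>\<^sup>+ p. ennreal ((norm (?\<phi> p))\<^sup>2) \<partial>intensity)"
    by (rule compensated_isometry_le) (intro Bochner_Integration.integrable_diff int)
  also have "\<dots> \<le> (\<integral>\<^sup>+ p. ennreal ((norm (snd p))\<^sup>2) * indicator {x. norm x < 1 / real n} (snd p) \<partial>intensity)"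
  proof (rule nn_integral_mono)
    fix p :: "real \<times> (real ^ 'd)"
    have "1 / real m \<le> 1 / real n"
      using assms by (simp add: frac_le)
    then show "ennreal ((norm (?\<phi> p))\<^sup>2) \<le> ennreal ((norm (snd p))\<^sup>2) * indicator {x. norm x < 1 / real n} (snd p)"
      by (auto simp: large_jump_def indicator_def)
  qed
  also have "\<dots> = ennreal T * (\<integral>\<^sup>+ x\<in>{x. norm x < 1 / real n}. ennreal ((norm x)\<^sup>2) \<partial>\<nu>)"
    by (rule nn_integral_intensity) measurable
  finally show ?thesis .
qed

text \<open>
  The approximations through which the stochastic integral \<open>X\<^sub>T\<close> is defined are exactly the \<open>X\<^sup>k\<^sub>T\<close>.
\<close>

lemma comp_integral_terminal:
  "X T \<in> borel_measurable M"
  "1 \<le> k \<Longrightarrow> trunc_process k T X \<nu> T \<in> borel_measurable M"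
  "(\<lambda>k. \<integral>\<^sup>+ \<omega>. ennreal ((norm (X T \<omega> - trunc_process k T X \<nu> T \<omega>))\<^sup>2) \<partial>M) \<longlonglongrightarrow> 0"
proof -
  have "has_comp_integral M (jump_measure T X) \<nu> (\<lambda>s \<omega> x. x) 0 T (X T)"
    using setting T_pos by (simp add: levy_setting_def)
  then show "X T \<in> borel_measurable M"
    "1 \<le> k \<Longrightarrow> trunc_process k T X \<nu> T \<in> borel_measurable M"
    "(\<lambda>k. \<integral>\<^sup>+ \<omega>. ennreal ((norm (X T \<omega> - trunc_process k T X \<nu> T \<omega>))\<^sup>2) \<partial>M) \<longlonglongrightarrow> 0"
    unfolding has_comp_integral_def trunc_process_def by blast+
qed

text \<open>
  Insert \<open>X\<^sup>m\<^sub>T\<close> between \<open>X\<^sub>T\<close> and \<open>X\<^sup>n\<^sub>T\<close> and let \<open>m\<close> tend to infinity. The factor 2 is the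
  price of splitting the square by \<open>(a + b)\<^sup>2 \<le> 2a\<^sup>2 + 2b\<^sup>2\<close>; since \<open>C\<^sub>\<beta>\<^sup>2\<close> contains the factor 4, it is
  affordable.
\<close>

lemma truncation_error:
  assumes "1 \<le> n"
  shows "(\<integral>\<^sup>+ \<omega>. ennreal ((norm (X T \<omega> - trunc_process n T X \<nu> T \<omega>))\<^sup>2) \<partial>M)
    \<le> 2 * (ennreal T * (\<integral>\<^sup>+ x\<in>{x. norm x < 1 / real n}. ennreal ((norm x)\<^sup>2) \<partial>\<nu>))" (is "?E \<le> 2 * ?B")
proof (rule LIMSEQ_le_const)
  let ?D = "\<lambda>k. \<integral>\<^sup>+ \<omega>. ennreal ((norm (X T \<omega> - trunc_process k T X \<nu> T \<omega>))\<^sup>2) \<partial>M"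
  have "(\<lambda>k. 2 * ?D k + 2 * ?B) \<longlonglongrightarrow> 2 * 0 + 2 * ?B"
    by (intro tendsto_add tendsto_const ennreal_tendsto_cmult comp_integral_terminal) simp
  then show "(\<lambda>k. 2 * ?D k + 2 * ?B) \<longlonglongrightarrow> 2 * ?B" by simp
  show "\<exists>K. \<forall>m\<ge>K. ?E \<le> 2 * ?D m + 2 * ?B"
  proof (intro exI[of _ n] allI impI)
    fix m assume "n \<le> m"
    let ?X = "\<lambda>k. trunc_process k T X \<nu> T"
    have "?E = (\<integral>\<^sup>+ \<omega>. ennreal ((norm ((X T \<omega> - ?X m \<omega>) + (?X m \<omega> - ?X n \<omega>)))\<^sup>2) \<partial>M)"
      by simp
    also have "\<dots> \<le> 2 * ?D m + 2 * (\<integral>\<^sup>+ \<omega>. ennreal ((norm (?X m \<omega> - ?X n \<omega>))\<^sup>2) \<partial>M)"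
      using assms \<open>n \<le> m\<close>
      by (intro nn_integral_norm_add_square_le borel_measurable_diff comp_integral_terminal) auto
    also have "\<dots> \<le> 2 * ?D m + 2 * ?B"
      using trunc_process_difference[OF assms \<open>n \<le> m\<close>] by (intro add_left_mono mult_left_mono) auto
    finally show "?E \<le> 2 * ?D m + 2 * ?B" .
  qed
qed

lemma second_moment_terminal: "(\<integral>\<^sup>+ \<omega>. ennreal ((norm (X T \<omega>))\<^sup>2) \<partial>M) < \<infinity>"
proof -
  let ?X = "trunc_process 1 T X \<nu> T"
  have "(\<integral>\<^sup>+ x\<in>{x. norm x < 1 / real 1}. ennreal ((norm x)\<^sup>2) \<partial>\<nu>) \<le> (\<integral>\<^sup>+ x. ennreal ((norm x)\<^sup>2) \<partial>\<nu>)"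
    by (intro nn_integral_mono) (auto simp: indicator_def)
  also note nn_integral_norm_square
  finally have "2 * (ennreal T * (\<integral>\<^sup>+ x\<in>{x. norm x < 1 / real 1}. ennreal ((norm x)\<^sup>2) \<partial>\<nu>)) < \<infinity>"
    by (simp add: ennreal_mult_less_top)
  with truncation_error[of 1]
  have "(\<integral>\<^sup>+ \<omega>. ennreal ((norm (X T \<omega> - ?X \<omega>))\<^sup>2) \<partial>M) < \<infinity>"
    by (auto elim: le_less_trans)
  moreover have "(\<integral>\<^sup>+ \<omega>. ennreal ((norm (X T \<omega>))\<^sup>2) \<partial>M)
      = (\<integral>\<^sup>+ \<omega>. ennreal ((norm ((X T \<omega> - ?X \<omega>) + ?X \<omega>))\<^sup>2) \<partial>M)"
    by simp
  moreover have "\<dots> \<le> 2 * (\<integral>\<^sup>+ \<omega>. ennreal ((norm (X T \<omega> - ?X \<omega>))\<^sup>2) \<partial>M)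
      + 2 * (\<integral>\<^sup>+ \<omega>. ennreal ((norm (?X \<omega>))\<^sup>2) \<partial>M)"
    by (intro nn_integral_norm_add_square_le borel_measurable_diff comp_integral_terminal) auto
  ultimately show ?thesis
    using second_moment_trunc_process[of 1] by (auto simp: ennreal_mult_less_top elim!: le_less_trans)
qed

section \<open>The rate of convergence\<close>

text \<open>
  Near the origin some exponent \<open>\<gamma> < \<beta>\<close> is integrable and \<open>norm x powr \<beta> \<le> norm x powr \<gamma>\<close>. The set
  of exponents whose infimum is the index contains 2, so this infimum is not that of the empty set and such a
  \<open>\<gamma>\<close> exists. Away from the origin \<open>norm x powr \<beta>\<close> is at most \<open>(norm x)\<^sup>2\<close>.
\<close>

lemma nn_integral_norm_powr_finite:
  assumes "bg_index \<nu> < \<beta>" "\<beta> < 2"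
  shows "(\<integral>\<^sup>+ x. ennreal (norm x powr \<beta>) \<partial>\<nu>) < \<infinity>"
proof -
  let ?S = "{\<beta>. \<beta> > 0 \<and> (\<integral>\<^sup>+ x\<in>{x. norm x \<le> 1}. ennreal (norm x powr \<beta>) \<partial>\<nu>) < \<infinity>}"
  have "(\<integral>\<^sup>+ x\<in>{x. norm x \<le> 1}. ennreal (norm x powr 2) \<partial>\<nu>) \<le> (\<integral>\<^sup>+ x. ennreal ((norm x)\<^sup>2) \<partial>\<nu>)"
    by (intro nn_integral_mono) (auto simp: indicator_def)
  also note nn_integral_norm_square
  finally have "2 \<in> ?S" by simp
  then obtain \<gamma> where \<gamma>: "\<gamma> > 0" "\<gamma> < \<beta>" "(\<integral>\<^sup>+ x\<in>{x. norm x \<le> 1}. ennreal (norm x powr \<gamma>) \<partial>\<nu>) < \<infinity>"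
    using cInf_lessD[of ?S \<beta>] assms(1) unfolding bg_index_def by blast
  have "(\<integral>\<^sup>+ x. ennreal (norm x powr \<beta>) \<partial>\<nu>)
      \<le> (\<integral>\<^sup>+ x. ennreal (norm x powr \<gamma>) * indicator {x. norm x \<le> 1} x + ennreal ((norm x)\<^sup>2) \<partial>\<nu>)"
  proof (rule nn_integral_mono)
    fix x :: "real ^ 'd"
    show "ennreal (norm x powr \<beta>) \<le> ennreal (norm x powr \<gamma>) * indicator {x. norm x \<le> 1} x + ennreal ((norm x)\<^sup>2)"
    proof (cases "norm x \<le> 1")
      case True
      then have "norm x powr \<beta> \<le> norm x powr \<gamma>"
        using \<gamma> by (intro powr_mono') auto
      then have "ennreal (norm x powr \<beta>) \<le> ennreal (norm x powr \<gamma>) + 0"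
        by (simp add: ennreal_leI)
      also have "\<dots> \<le> ennreal (norm x powr \<gamma>) + ennreal ((norm x)\<^sup>2)"
        by (rule add_left_mono) simp
      finally show ?thesis
        using True by simp
    next
      case False
      then have "norm x powr \<beta> \<le> norm x powr 2"
        using assms by (intro powr_mono) auto
      then show ?thesis
        using False by (simp add: ennreal_leI)
    qed
  qed
  also have "\<dots> = (\<integral>\<^sup>+ x\<in>{x. norm x \<le> 1}. ennreal (norm x powr \<gamma>) \<partial>\<nu>) + (\<integral>\<^sup>+ x. ennreal ((norm x)\<^sup>2) \<partial>\<nu>)"
    by (intro nn_integral_add) measurable
  also have "\<dots> < \<infinity>"
    using \<gamma>(3) nn_integral_norm_square by simp
  finally show ?thesis .
qed

text \<open>
  The source of the rate: on small jumps
  \<open>(norm x)\<^sup>2 = norm x powr \<beta> * norm x powr (2 - \<beta>) \<le> norm x powr \<beta> * (1/n) powr (2 - \<beta>)\<close>.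
\<close>

lemma small_jumps_second_moment:
  assumes \<beta>: "bg_index \<nu> < \<beta>" "\<beta> < 2" and "1 \<le> n"
  shows "(\<integral>\<^sup>+ x\<in>{x. norm x < 1 / real n}. ennreal ((norm x)\<^sup>2) \<partial>\<nu>)
    \<le> ennreal ((\<integral>x. norm x powr \<beta> \<partial>\<nu>) / real n powr (2 - \<beta>))"
proof -
  have fin: "integrable \<nu> (\<lambda>x. norm x powr \<beta>)"
    using nn_integral_norm_powr_finite[OF \<beta>] by (intro integrableI_bounded) auto
  have "(\<integral>\<^sup>+ x\<in>{x. norm x < 1 / real n}. ennreal ((norm x)\<^sup>2) \<partial>\<nu>)
      \<le> (\<integral>\<^sup>+ x. ennreal (norm x powr \<beta> / real n powr (2 - \<beta>)) \<partial>\<nu>)"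
  proof (rule nn_integral_mono)
    fix x :: "real ^ 'd"
    have "(norm x)\<^sup>2 \<le> norm x powr \<beta> / real n powr (2 - \<beta>)" if "norm x < 1 / real n"
    proof (cases "x = 0")
      case False
      then have "(norm x)\<^sup>2 = norm x powr \<beta> * norm x powr (2 - \<beta>)"
        by (simp add: powr_numeral flip: powr_add)
      also have "\<dots> \<le> norm x powr \<beta> * (1 / real n) powr (2 - \<beta>)"
        using that \<beta> by (intro mult_left_mono powr_mono2) auto
      finally show ?thesis
        by (simp add: powr_divide)
    qed simp
    then show "ennreal ((norm x)\<^sup>2) * indicator {x. norm x < 1 / real n} x
        \<le> ennreal (norm x powr \<beta> / real n powr (2 - \<beta>))"
      by (auto simp: indicator_def intro!: ennreal_leI)
  qed
  also have "\<dots> = ennreal (\<integral>x. norm x powr \<beta> / real n powr (2 - \<beta>) \<partial>\<nu>)"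
    by (rule nn_integral_eq_integral) (use fin in auto)
  finally show ?thesis by simp
qed

lemma terminal_value_error:
  fixes g :: "real ^ 'd \<Rightarrow> real"
  assumes lip: "\<And>x x'. \<bar>g x - g x'\<bar> \<le> L * norm (x - x')" and "0 \<le> L"
    and \<beta>: "bg_index \<nu> < \<beta>" "\<beta> < 2" and n: "1 \<le> n"
  shows "esqrt (\<integral>\<^sup>+ \<omega>. ennreal (\<bar>g (trunc_process n T X \<nu> T \<omega>) - g (X T \<omega>)\<bar>\<^sup>2) \<partial>M)
    \<le> ennreal (L * (2 * sqrt (\<integral>x. norm x powr \<beta> \<partial>\<nu>) * sqrt T / real n powr (1 - \<beta> / 2)))"
proof (rule esqrt_le)
  let ?X = "trunc_process n T X \<nu> T" and ?I = "\<integral>x. norm x powr \<beta> \<partial>\<nu>"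
  have I: "0 \<le> ?I" by simp
  have "(\<integral>\<^sup>+ \<omega>. ennreal (\<bar>g (?X \<omega>) - g (X T \<omega>)\<bar>\<^sup>2) \<partial>M)
      \<le> (\<integral>\<^sup>+ \<omega>. ennreal (L\<^sup>2) * ennreal ((norm (X T \<omega> - ?X \<omega>))\<^sup>2) \<partial>M)"
  proof (rule nn_integral_mono)
    fix \<omega>
    have "\<bar>g (?X \<omega>) - g (X T \<omega>)\<bar>\<^sup>2 \<le> (L * norm (X T \<omega> - ?X \<omega>))\<^sup>2"
      using lip[of "X T \<omega>" "?X \<omega>"] by (intro power_mono) (auto simp: abs_minus_commute)
    then show "ennreal (\<bar>g (?X \<omega>) - g (X T \<omega>)\<bar>\<^sup>2) \<le> ennreal (L\<^sup>2) * ennreal ((norm (X T \<omega> - ?X \<omega>))\<^sup>2)"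
      by (simp add: ennreal_leI power_mult_distrib flip: ennreal_mult')
  qed
  also have "\<dots> = ennreal (L\<^sup>2) * (\<integral>\<^sup>+ \<omega>. ennreal ((norm (X T \<omega> - ?X \<omega>))\<^sup>2) \<partial>M)"
    using comp_integral_terminal(1) comp_integral_terminal(2)[OF n] by (intro nn_integral_cmult) measurable
  also have "\<dots> \<le> ennreal (L\<^sup>2) * (2 * (ennreal T * ennreal (?I / real n powr (2 - \<beta>))))"
    by (intro mult_left_mono order_trans[OF truncation_error[OF n]] small_jumps_second_moment \<beta> n) auto
  also have "\<dots> = ennreal (L\<^sup>2 * (2 * (T * (?I / real n powr (2 - \<beta>)))))"
    using T_pos by (simp only: ennreal_mult' zero_le_power2 zero_le_numeral less_imp_le ennreal_numeral)
  also have "\<dots> \<le> ennreal ((L * (2 * sqrt ?I * sqrt T / real n powr (1 - \<beta> / 2)))\<^sup>2)"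
  proof (rule ennreal_leI)
    have "(real n powr (1 - \<beta> / 2))\<^sup>2 = real n powr (2 - \<beta>)"
      by (simp add: power2_eq_square flip: powr_add)
    \<comment> \<open>The constant 2 in front of the root has square 4, twice what the truncation error requires.\<close>
    then have eq: "(L * (2 * sqrt ?I * sqrt T / real n powr (1 - \<beta> / 2)))\<^sup>2
        = 2 * (L\<^sup>2 * (2 * (T * (?I / real n powr (2 - \<beta>)))))"
      using T_pos I by (simp add: power_mult_distrib power_divide)
    have "0 \<le> L\<^sup>2 * (2 * (T * (?I / real n powr (2 - \<beta>))))"
      using T_pos I by simp
    then show "L\<^sup>2 * (2 * (T * (?I / real n powr (2 - \<beta>))))
        \<le> (L * (2 * sqrt ?I * sqrt T / real n powr (1 - \<beta> / 2)))\<^sup>2"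
      unfolding eq by (simp only: mult_2 le_add_same_cancel1)
  qed
  finally show "(\<integral>\<^sup>+ \<omega>. ennreal (\<bar>g (?X \<omega>) - g (X T \<omega>)\<bar>\<^sup>2) \<partial>M)
      \<le> ennreal ((L * (2 * sqrt ?I * sqrt T / real n powr (1 - \<beta> / 2)))\<^sup>2)" .
  show "0 \<le> L * (2 * sqrt ?I * sqrt T / real n powr (1 - \<beta> / 2))"
    using T_pos I \<open>0 \<le> L\<close> by simp
qed

end

theorem corollary3p5:
  fixes M :: "'w measure" and X :: "real \<Rightarrow> 'w \<Rightarrow> real ^ 'd" and \<nu> :: "(real ^ 'd) measure"
    and f :: "real \<Rightarrow> real \<Rightarrow> (real ^ 'd \<Rightarrow> real) \<Rightarrow> real" and g :: "real ^ 'd \<Rightarrow> real"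
    and Y :: "real \<Rightarrow> 'w \<Rightarrow> real" and U :: "real \<Rightarrow> 'w \<Rightarrow> real ^ 'd \<Rightarrow> real"
    and Y\<^sub>n :: "nat \<Rightarrow> real \<Rightarrow> 'w \<Rightarrow> real" and U\<^sub>n :: "nat \<Rightarrow> real \<Rightarrow> 'w \<Rightarrow> real ^ 'd \<Rightarrow> real"
    and T L\<^sub>f L\<^sub>g C \<beta> :: real
  assumes setting: "levy_setting M T X \<nu>"
    and f_lipschitz: "lipschitz_generator T \<nu> L\<^sub>f f"
    and f_zero: "sq_integrable_at_zero T f"
    and g_lipschitz: "\<And>x x'. \<bar>g x - g x'\<bar> \<le> L\<^sub>g * norm (x - x')"
    and YU: "full_bsde_solution M T X \<nu> f (\<lambda>\<omega>. g (X T \<omega>)) Y U"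
    and YUn: "\<And>n. 1 \<le> n \<Longrightarrow>
      trunc_bsde_solution n M T X \<nu> f (\<lambda>\<omega>. g (trunc_process n T X \<nu> T \<omega>)) (Y\<^sub>n n) (U\<^sub>n n)"
    and C: "stability_constant TYPE('w) TYPE('d) L\<^sub>f T C"
    and index: "bg_index \<nu> < 2"
    and \<beta>: "bg_index \<nu> < \<beta>" "\<beta> < 2"
  shows "\<exists>C'. C' = C * L\<^sub>g \<and>
    (\<forall>n\<ge>1.
      Y_distance M T (Y\<^sub>n n) Y
        \<le> ennreal (C' * ((2 * sqrt (\<integral>x. norm x powr \<beta> \<partial>\<nu>)) * sqrt T / real n powr (1 - \<beta> / 2))) \<and>
      U_distance M T \<nu> (\<lambda>t \<omega>. large_part n (U\<^sub>n n t \<omega>)) U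
        \<le> ennreal (C' * ((2 * sqrt (\<integral>x. norm x powr \<beta> \<partial>\<nu>)) * sqrt T / real n powr (1 - \<beta> / 2))))"
proof -
  interpret levy_martingale M T X \<nu>
    by unfold_locales (rule setting)
  \<comment> \<open>Test the Lipschitz condition on the origin and a unit vector.\<close>
  have "0 \<le> L\<^sub>g"
    using order_trans[OF abs_ge_zero g_lipschitz[of "axis undefined 1" 0]] by simp
  then have "L\<^sub>g-lipschitz_on UNIV g"
    using g_lipschitz by (intro lipschitz_onI) (auto simp: dist_norm)
  then have [measurable]: "g \<in> borel_measurable borel"
    by (intro borel_measurable_continuous_onI lipschitz_on_continuous_on)
  have "0 \<le> C"
    using C by (simp add: stability_constant_def)
  have "Y_distance M T (Y\<^sub>n n) Y
        \<le> ennreal (C * L\<^sub>g * ((2 * sqrt (\<integral>x. norm x powr \<beta> \<partial>\<nu>)) * sqrt T / real n powr (1 - \<beta> / 2))) \<and>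
      U_distance M T \<nu> (\<lambda>t \<omega>. large_part n (U\<^sub>n n t \<omega>)) U
        \<le> ennreal (C * L\<^sub>g * ((2 * sqrt (\<integral>x. norm x powr \<beta> \<partial>\<nu>)) * sqrt T / real n powr (1 - \<beta> / 2)))"
    if n: "1 \<le> n" for n
  proof -
    let ?X = "trunc_process n T X \<nu> T"
    let ?d = "esqrt (\<integral>\<^sup>+ \<omega>. ennreal (\<bar>g (?X \<omega>) - g (X T \<omega>)\<bar>\<^sup>2) \<partial>M)"
    have "(\<lambda>\<omega>. g (X T \<omega>)) \<in> borel_measurable (levy_filtration M T X T)"
      "(\<lambda>\<omega>. g (?X \<omega>)) \<in> borel_measurable (levy_filtration M T (trunc_process n T X \<nu>) T)"
      by (rule measurable_compose[OF measurable_usual_augmentation_terminal], use T_pos in simp, simp)+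
    moreover have "(\<integral>\<^sup>+ \<omega>. ennreal (\<bar>g (X T \<omega>)\<bar>\<^sup>2) \<partial>M) < \<infinity>"
      by (rule lipschitz_square_integrable[OF g_lipschitz comp_integral_terminal(1) second_moment_terminal])
    moreover have "(\<integral>\<^sup>+ \<omega>. ennreal (\<bar>g (?X \<omega>)\<bar>\<^sup>2) \<partial>M) < \<infinity>"
      by (rule lipschitz_square_integrable[OF g_lipschitz comp_integral_terminal(2)[OF n]
            second_moment_trunc_process[OF n]])
    ultimately have stable: "Y_distance M T (Y\<^sub>n n) Y \<le> ennreal C * ?d"
      "U_distance M T \<nu> (\<lambda>t \<omega>. large_part n (U\<^sub>n n t \<omega>)) U \<le> ennreal C * ?d"
      using C setting f_lipschitz f_zero n YU YUn[OF n] unfolding stability_constant_def by blast+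
    have "ennreal C * ?d
        \<le> ennreal (C * L\<^sub>g * ((2 * sqrt (\<integral>x. norm x powr \<beta> \<partial>\<nu>)) * sqrt T / real n powr (1 - \<beta> / 2)))"
      unfolding mult.assoc[of C] ennreal_mult'[OF \<open>0 \<le> C\<close>]
      by (intro mult_left_mono terminal_value_error[OF g_lipschitz \<open>0 \<le> L\<^sub>g\<close> \<beta> n]) simp
    then show ?thesis
      using stable by (auto intro: order_trans)
  qed
  then show ?thesis by blast
qed

end
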